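(* Let $G$ be a finite group and let $K$ be the conjugacy class of an element $x\in G$. Then $K^n=D\cup D^{-1}$, where $D$ is a conjugacy class, if and only if there exist positive integers $m_1$ and $m_2$ such that $$\chi(x)^n|K|^n=\chi(1)^{n-1}|D|\bigl(m_1\chi(x^n)+m_2\chi(x^{-n})\bigr)$$ for all $\chi\in\mathrm{Irr}(G)$ and $|K|^n=(m_1+m_2)|D|$, where $$m_1=\frac{|K|^n}{|G|}\sum_{\chi\in\mathrm{Irr}(G)}\frac{\chi(x)^n\,\overline{\chi(x^n)}}{\chi(1)^{n-1}}\qquad\text{and}\qquad m_2=\frac{|K|^n}{|G|}\sum_{\chi\in\mathrm{Irr}(G)}\frac{\chi(x)^n\,\chi(x^n)}{\chi(1)^{n-1}}.$$ In particular, $$\chi(x)^n+\chi(x^{-1})^n=\chi(1)^{n-1}\bigl(\chi(x^n)+\chi(x^{-n})\bigr)$$ for all $\chi\in\mathrm{Irr}(G)$.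
   Context: $n$ is a positive integer; $K^n$ is the set of all products of $n$ elements of $K$; $D^{-1}=\{d^{-1}: d\in D\}$; $\mathrm{Irr}(G)$ is the set of irreducible complex characters of $G$.
   Formalization: The equivalence adds D ≠ D^{-1} to the left side (it fails for D = D^{-1}, e.g. x = 1, where m1 = m2 = 1 but |K|^n = 1) and x^n ∈ D ∪ D^{-1} to the right side (otherwise any class of the same size as D would satisfy it). *)

theory Defs
  imports
    "Jordan_Normal_Form.VS_Connect"
    "HOL-Algebra.Group_Action"
    "HOL-Algebra.Coset"
begin

definition conj_action :: "('a, 'b) monoid_scheme \<Rightarrow> 'a \<Rightarrow> 'a \<Rightarrow> 'a" where
  "conj_action G = (\<lambda>g. \<lambda>h \<in> carrier G. g \<otimes>\<^bsub>G\<^esub> h \<otimes>\<^bsub>G\<^esub> inv\<^bsub>G\<^esub> g)"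

definition conj_class :: "('a, 'b) monoid_scheme \<Rightarrow> 'a \<Rightarrow> 'a set" where
  "conj_class G x = orbit G (conj_action G) x"

definition conj_classes :: "('a, 'b) monoid_scheme \<Rightarrow> 'a set set" where
  "conj_classes G = orbits G (carrier G) (conj_action G)"

primrec set_pow :: "('a, 'b) monoid_scheme \<Rightarrow> 'a set \<Rightarrow> nat \<Rightarrow> 'a set" where
  "set_pow G K 0 = {\<one>\<^bsub>G\<^esub>}"
| "set_pow G K (Suc n) = set_pow G K n <#>\<^bsub>G\<^esub> K"

definition mat_trace :: "'a :: comm_monoid_add mat \<Rightarrow> 'a" where
  "mat_trace A = (\<Sum>i < dim_row A. A $$ (i, i))"

text \<open>A complex representation of degree d is a homomorphism into GL(d, C), the unit group of
  the ring of d by d matrices.\<close>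

definition is_rep :: "('a, 'b) monoid_scheme \<Rightarrow> nat \<Rightarrow> ('a \<Rightarrow> complex mat) \<Rightarrow> bool" where
  "is_rep G d \<rho> \<longleftrightarrow> \<rho> \<in> hom G (units_of (ring_mat TYPE(complex) d ()))"

definition irreducible_rep :: "('a, 'b) monoid_scheme \<Rightarrow> nat \<Rightarrow> ('a \<Rightarrow> complex mat) \<Rightarrow> bool" where
  "irreducible_rep G d \<rho> \<longleftrightarrow> is_rep G d \<rho> \<and> 0 < d \<and>
     (\<forall>W. subspace class_ring W (module_vec TYPE(complex) d) \<and>
          (\<forall>g \<in> carrier G. \<forall>w \<in> W. \<rho> g *\<^sub>v w \<in> W)
          \<longrightarrow> W = {0\<^sub>v d} \<or> W = carrier_vec d)"

text \<open>Characters are cut off outside the carrier, so that equality of characters in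
  \<open>Irr G\<close> means equality on the group and every character is counted once.\<close>

definition rep_character :: "('a, 'b) monoid_scheme \<Rightarrow> ('a \<Rightarrow> complex mat) \<Rightarrow> 'a \<Rightarrow> complex" where
  "rep_character G \<rho> = (\<lambda>g \<in> carrier G. mat_trace (\<rho> g))"

definition Irr :: "('a, 'b) monoid_scheme \<Rightarrow> ('a \<Rightarrow> complex) set" where
  "Irr G = {rep_character G \<rho> | d \<rho>. irreducible_rep G d \<rho>}"

end

theory Submission
  imports Defs "Jordan_Normal_Form.Spectral_Radius" "HOL-Algebra.Multiplicative_Group"
begin

text \<open>By Schur's lemma, a class function \<open>f\<close>, viewed as an element of the group algebra, acts on an
  irreducible representation as a scalar. Together with
  \<open>(\<Sum>\<chi>\<in>Irr G. \<chi> 1 * \<chi> g) = |G| [g = 1]\<close>, read off from the regular representation, this gives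
  \<open>|G| f k = (\<Sum>\<chi>\<in>Irr G. (\<Sum>g. f g * \<chi> g) * \<chi> (inverse k))\<close>, so a class function is determined by its
  character sums. Apply this to the number \<open>\<nu> g\<close> of ways to write \<open>g\<close> as a product of \<open>n\<close> elements
  of \<open>K\<close>, whose character sums are \<open>|K|^n \<chi>(x)^n / \<chi>(1)^(n - 1)\<close>: the formulas for \<open>m1\<close> and \<open>m2\<close>
  say \<open>m1 = \<nu> (x^n)\<close> and \<open>m2 = \<nu> (x^(-n))\<close>, and the character identity says that \<open>\<nu>\<close> is \<open>m1\<close> times
  the indicator of the class of \<open>x^n\<close> plus \<open>m2\<close> times that of the class of \<open>x^(-n)\<close>.\<close>

section \<open>Traces and invariant subspaces of matrices\<close>

text \<open>The group algebra is never built: a class function acts through the matrix whose entries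
  are the sums of f(g) \<rho>(g), written with \<open>mat_sum\<close>, so that everything happens
  with matrices and traces. Row orthogonality is used for one purpose, to identify the
  multiplicities in the regular representation with the degrees. The same argument shows that
  \<open>Irr G\<close> is finite, without which the sums over it would be 0 by convention. The
  equivalence concerns a class D different from its inverse. If D = D^(-1) and K^n = D, then both
  formulas give \<nu>(x^n), so m1 = m2 = \<nu>(x^n), while counting all n-tuples gives |K|^n =
  \<nu>(x^n) |D| and not (m1 + m2) |D|. The final character identity has no such obstacle, and its
  proof avoids splitting the count over two disjoint classes.\<close>

lemma mat_trace_mult_comm:
  fixes A B :: "'a :: comm_semiring_0 mat"
  assumes "A \<in> carrier_mat n m" "B \<in> carrier_mat m n"
  shows "mat_trace (A * B) = mat_trace (B * A)"
proof -
  have "mat_trace (A * B) = (\<Sum>i<n. \<Sum>j<m. A $$ (i,j) * B $$ (j,i))"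
    unfolding mat_trace_def using assms
    by (intro sum.cong) (auto simp: scalar_prod_def lessThan_atLeast0)
  also have "\<dots> = (\<Sum>j<m. \<Sum>i<n. B $$ (j,i) * A $$ (i,j))"
    by (subst sum.swap) (simp add: mult.commute)
  also have "\<dots> = mat_trace (B * A)"
    unfolding mat_trace_def using assms
    by (intro sum.cong) (auto simp: scalar_prod_def lessThan_atLeast0)
  finally show ?thesis .
qed

lemma mat_trace_add:
  assumes "A \<in> carrier_mat n n" "B \<in> carrier_mat n n"
  shows "mat_trace (A + B) = mat_trace A + mat_trace B"
  using assms by (simp add: mat_trace_def sum.distrib)

lemma mat_trace_smult:
  fixes A :: "'a :: semiring_0 mat"
  assumes "A \<in> carrier_mat n n"
  shows "mat_trace (c \<cdot>\<^sub>m A) = c * mat_trace A"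
  using assms by (simp add: mat_trace_def sum_distrib_left)

lemma mat_trace_one: "mat_trace (1\<^sub>m n :: 'a :: semiring_1 mat) = of_nat n"
  by (simp add: mat_trace_def)

text \<open>Matrices of all sizes share one type and have no common zero, so the dimensions are
  arguments; the sum over the empty set is then the zero matrix of the right size.\<close>

definition mat_sum :: "nat \<Rightarrow> nat \<Rightarrow> ('i \<Rightarrow> 'a :: comm_monoid_add mat) \<Rightarrow> 'i set \<Rightarrow> 'a mat" where
  "mat_sum n m F S = mat n m (\<lambda>ij. \<Sum>s\<in>S. F s $$ ij)"

lemma mat_sum_carrier [simp]: "mat_sum n m F S \<in> carrier_mat n m"
  by (simp add: mat_sum_def)

lemma mat_sum_index [simp]:
  "i < n \<Longrightarrow> j < m \<Longrightarrow> mat_sum n m F S $$ (i, j) = (\<Sum>s\<in>S. F s $$ (i, j))"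
  by (simp add: mat_sum_def)

lemma mat_sum_dim [simp]: "dim_row (mat_sum n m F S) = n" "dim_col (mat_sum n m F S) = m"
  by (simp_all add: mat_sum_def)

lemma mat_sum_cong: "(\<And>s. s \<in> S \<Longrightarrow> F s = H s) \<Longrightarrow> mat_sum n m F S = mat_sum n m H S"
  by (auto simp: mat_sum_def intro!: eq_matI sum.cong)

lemma mat_sum_reindex:
  "bij_betw h S T \<Longrightarrow> mat_sum n m F T = mat_sum n m (\<lambda>s. F (h s)) S"
  unfolding mat_sum_def
  by (intro arg_cong[where f = "mat n m"] ext) (rule sum.reindex_bij_betw[symmetric])

lemma mult_mat_sum:
  fixes A :: "'a :: comm_semiring_0 mat"
  assumes "A \<in> carrier_mat l n" "\<And>s. s \<in> S \<Longrightarrow> F s \<in> carrier_mat n m"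
  shows "A * mat_sum n m F S = mat_sum l m (\<lambda>s. A * F s) S"
proof (rule eq_matI)
  fix i j assume ij: "i < dim_row (mat_sum l m (\<lambda>s. A * F s) S)" "j < dim_col (mat_sum l m (\<lambda>s. A * F s) S)"
  have "(A * mat_sum n m F S) $$ (i,j) = (\<Sum>k=0..<n. \<Sum>s\<in>S. A $$ (i,k) * F s $$ (k,j))"
    using ij assms(1) by (auto simp: scalar_prod_def sum_distrib_left)
  also have "\<dots> = (\<Sum>s\<in>S. \<Sum>k=0..<n. A $$ (i,k) * F s $$ (k,j))" by (rule sum.swap)
  also have "\<dots> = (\<Sum>s\<in>S. (A * F s) $$ (i,j))"
  proof (rule sum.cong)
    fix s assume "s \<in> S"
    with assms(2)[OF this] show "(\<Sum>k=0..<n. A $$ (i,k) * F s $$ (k,j)) = (A * F s) $$ (i,j)"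
      using ij assms(1) by (auto simp: scalar_prod_def)
  qed simp
  finally show "(A * mat_sum n m F S) $$ (i,j) = mat_sum l m (\<lambda>s. A * F s) S $$ (i,j)"
    using ij by simp
qed (use assms in auto)

lemma mat_sum_mult:
  fixes A :: "'a :: comm_semiring_0 mat"
  assumes "A \<in> carrier_mat m l" "\<And>s. s \<in> S \<Longrightarrow> F s \<in> carrier_mat n m"
  shows "mat_sum n m F S * A = mat_sum n l (\<lambda>s. F s * A) S"
proof (rule eq_matI)
  fix i j assume ij: "i < dim_row (mat_sum n l (\<lambda>s. F s * A) S)" "j < dim_col (mat_sum n l (\<lambda>s. F s * A) S)"
  have "(mat_sum n m F S * A) $$ (i,j) = (\<Sum>k=0..<m. \<Sum>s\<in>S. F s $$ (i,k) * A $$ (k,j))"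
    using ij assms(1) by (auto simp: scalar_prod_def sum_distrib_right)
  also have "\<dots> = (\<Sum>s\<in>S. \<Sum>k=0..<m. F s $$ (i,k) * A $$ (k,j))" by (rule sum.swap)
  also have "\<dots> = (\<Sum>s\<in>S. (F s * A) $$ (i,j))"
  proof (rule sum.cong)
    fix s assume "s \<in> S"
    with assms(2)[OF this] show "(\<Sum>k=0..<m. F s $$ (i,k) * A $$ (k,j)) = (F s * A) $$ (i,j)"
      using ij assms(1) by (auto simp: scalar_prod_def)
  qed simp
  finally show "(mat_sum n m F S * A) $$ (i,j) = mat_sum n l (\<lambda>s. F s * A) S $$ (i,j)"
    using ij by simp
qed (use assms in auto)

lemma mat_trace_mat_sum:
  assumes "\<And>s. s \<in> S \<Longrightarrow> F s \<in> carrier_mat n n"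
  shows "mat_trace (mat_sum n n F S) = (\<Sum>s\<in>S. mat_trace (F s))"
proof -
  have "mat_trace (mat_sum n n F S) = (\<Sum>i<n. \<Sum>s\<in>S. F s $$ (i,i))"
    by (simp add: mat_trace_def)
  also have "\<dots> = (\<Sum>s\<in>S. \<Sum>i<n. F s $$ (i,i))" by (rule sum.swap)
  also have "\<dots> = (\<Sum>s\<in>S. mat_trace (F s))"
    using assms by (intro sum.cong) (auto simp: mat_trace_def)
  finally show ?thesis .
qed

text \<open>In the expansion of entry (i,j) of \<open>B ^\<^sub>m k * B\<close> the term with middle
  index l vanishes unless i \<le> l \<le> j. Nothing survives below the diagonal, and only l = i on
  it.\<close>

lemma upper_triangular_pow:
  fixes B :: "'a :: comm_semiring_1 mat"
  assumes B: "B \<in> carrier_mat n n" and ut: "upper_triangular B"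
  shows "upper_triangular (B ^\<^sub>m k) \<and> (\<forall>i<n. (B ^\<^sub>m k) $$ (i,i) = (B $$ (i,i)) ^ k)"
proof (induction k)
  case 0
  then show ?case using B by (auto simp: upper_triangular_def)
next
  case (Suc k)
  have Bk: "B ^\<^sub>m k \<in> carrier_mat n n" using B by simp
  have zero: "(B ^\<^sub>m k) $$ (i,l) * B $$ (l,j) = 0"
    if "i < n" "j < n" "l < n" "j < i \<or> l < i \<or> j < l" for i j l
  proof (cases "l < i")
    case True
    then show ?thesis using Suc that Bk by (auto simp: upper_triangular_def)
  next
    case False
    then have "j < l" using that by auto
    then show ?thesis using ut that B by (auto simp: upper_triangular_def)
  qed
  have ent: "(B ^\<^sub>m Suc k) $$ (i,j) = (\<Sum>l=0..<n. (B ^\<^sub>m k) $$ (i,l) * B $$ (l,j))"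
    if "i < n" "j < n" for i j
    using that B Bk by (auto simp: scalar_prod_def)
  have "(B ^\<^sub>m Suc k) $$ (i,i) = B $$ (i,i) ^ Suc k" if i: "i < n" for i
  proof -
    have "(\<Sum>l=0..<n. (B ^\<^sub>m k) $$ (i,l) * B $$ (l,i)) = (\<Sum>l\<in>{i}. (B ^\<^sub>m k) $$ (i,l) * B $$ (l,i))"
      using i by (intro sum.mono_neutral_right) (auto intro!: zero simp: nat_neq_iff)
    then show ?thesis using ent[OF i i] Suc i by (simp add: mult.commute)
  qed
  moreover have "upper_triangular (B ^\<^sub>m Suc k)"
    unfolding upper_triangular_def
  proof (intro allI impI)
    fix i j assume "i < dim_row (B ^\<^sub>m Suc k)" "j < i"
    then have ij: "i < n" "j < n" "j < i" using B Bk by auto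
    show "(B ^\<^sub>m Suc k) $$ (i,j) = 0"
      unfolding ent[OF ij(1,2)] using ij by (intro sum.neutral) (auto intro!: zero)
  qed
  ultimately show ?case by blast
qed

lemma similar_mat_trace:
  fixes A :: "'a :: comm_semiring_1 mat"
  assumes "similar_mat A B"
  shows "mat_trace A = mat_trace B"
proof -
  obtain P Q where "similar_mat_wit A B P Q" using assms by (auto simp: similar_mat_def)
  then obtain n where c: "A \<in> carrier_mat n n" "B \<in> carrier_mat n n" "P \<in> carrier_mat n n"
    "Q \<in> carrier_mat n n" and w: "Q * P = 1\<^sub>m n" "A = P * B * Q"
    by (auto simp: similar_mat_wit_def Let_def)
  have "mat_trace A = mat_trace (Q * (P * B))"
    unfolding w(2) using c by (intro mat_trace_mult_comm) auto
  also have "Q * (P * B) = (Q * P) * B" using c by (simp add: assoc_mult_mat)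
  finally show ?thesis using w c by simp
qed

text \<open>The eigenvalues of a matrix of finite multiplicative order have absolute value 1, so passing
  to the inverse conjugates them.\<close>

lemma mat_trace_finite_order:
  fixes A :: "complex mat"
  assumes A: "A \<in> carrier_mat n n" and pow: "A ^\<^sub>m Suc k = 1\<^sub>m n"
  shows "mat_trace (A ^\<^sub>m k) = cnj (mat_trace A)"
proof -
  obtain es where "char_poly A = (\<Prod>a\<leftarrow>es. [:- a, 1:])"
    using char_poly_factorized[OF A] by auto
  \<comment> \<open>The trace and the relation \<open>A ^\<^sub>m Suc k = 1\<^sub>m n\<close>
    survive the passage to a similar triangular \<open>B\<close>, so the claim reduces to one about
    the diagonal entries of \<open>B\<close>, which are roots of unity.\<close>
  from schur_decomposition_exists[OF A this] obtain B where
    B: "B \<in> carrier_mat n n" "upper_triangular B" "similar_mat A B" by auto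
  have sim: "similar_mat (A ^\<^sub>m l) (B ^\<^sub>m l)" for l
    using B(3) unfolding similar_mat_def by (blast intro: similar_mat_wit_pow)
  have "similar_mat (1\<^sub>m n) (B ^\<^sub>m Suc k)" using sim[of "Suc k"] pow by simp
  then obtain P Q where "similar_mat_wit (B ^\<^sub>m Suc k) (1\<^sub>m n) P Q"
    using similar_mat_sym unfolding similar_mat_def by blast
  then have B1: "B ^\<^sub>m Suc k = 1\<^sub>m n" using B(1)
    by (auto simp: similar_mat_wit_def Let_def)
  have d: "(B ^\<^sub>m l) $$ (i,i) = B $$ (i,i) ^ l" if "i < n" for i l
    using upper_triangular_pow[OF B(1,2)] that by blast
  have "(B ^\<^sub>m k) $$ (i,i) = cnj (B $$ (i,i))" if i: "i < n" for i
  proof -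
    let ?b = "B $$ (i,i)"
    have one: "?b ^ Suc k = 1" using d[OF i, of "Suc k"] B1 i by simp
    then have "norm ?b ^ Suc k = 1 ^ Suc k" by (metis norm_one norm_power power_one)
    then have "norm ?b = 1" by (rule power_eq_imp_eq_base) auto
    then have "?b * cnj ?b = 1" by (simp add: complex_norm_square[symmetric])
    moreover have "?b * ?b ^ k = 1" using one by simp
    ultimately have "?b ^ k = cnj ?b"
      using mult_left_cancel[of ?b "?b ^ k" "cnj ?b"] by fastforce
    then show ?thesis using d[OF i] by simp
  qed
  then have "mat_trace (B ^\<^sub>m k) = cnj (mat_trace B)"
    using B(1) by (auto simp: mat_trace_def)
  then show ?thesis using similar_mat_trace[OF sim[of k]] similar_mat_trace[OF B(3)] by simp
qed

section \<open>Subspaces of coordinate space described by matrices\<close>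

lemma subspace_vec_iff:
  fixes W :: "'a :: field vec set"
  shows "VectorSpace.subspace class_ring W (module_vec TYPE('a) d) \<longleftrightarrow>
    W \<subseteq> carrier_vec d \<and> 0\<^sub>v d \<in> W \<and> (\<forall>v\<in>W. \<forall>w\<in>W. v + w \<in> W) \<and> (\<forall>c. \<forall>v\<in>W. c \<cdot>\<^sub>v v \<in> W)"
  unfolding VectorSpace.subspace_def submodule_def
  using vec_vs[where 'a = 'a and n = d] vec_module[where 'a = 'a and n = d]
  by (auto simp: module_vec_simps class_ring_simps)

text \<open>If k > d, pad both matrices with zeros to size k by k. The product
  \<open>L' * B'\<close> is still the identity, hence so is \<open>B' * L'\<close>; but rows d and
  beyond of \<open>B'\<close> are zero.\<close>

lemma left_inverse_dim_le:
  fixes L B :: "'a :: field mat"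
  assumes L: "L \<in> carrier_mat k d" and B: "B \<in> carrier_mat d k" and LB: "L * B = 1\<^sub>m k"
  shows "k \<le> d"
proof (rule ccontr)
  assume "\<not> k \<le> d"
  then have dk: "d < k" by simp
  define B' where "B' = mat k k (\<lambda>(i,j). if i < d then B $$ (i,j) else 0)"
  define L' where "L' = mat k k (\<lambda>(i,j). if j < d then L $$ (i,j) else 0)"
  have c: "B' \<in> carrier_mat k k" "L' \<in> carrier_mat k k" by (auto simp: B'_def L'_def)
  have "L' * B' = 1\<^sub>m k"
  proof (rule eq_matI)
    fix i j assume ij: "i < dim_row (1\<^sub>m k :: 'a mat)" "j < dim_col (1\<^sub>m k :: 'a mat)"
    have "(L' * B') $$ (i,j) = (\<Sum>l=0..<k. (if l < d then L $$ (i,l) * B $$ (l,j) else 0))"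
      using ij by (auto simp: B'_def L'_def scalar_prod_def intro!: sum.cong)
    also have "\<dots> = (\<Sum>l=0..<d. L $$ (i,l) * B $$ (l,j))"
      using dk by (intro sum.mono_neutral_cong_right) auto
    also have "\<dots> = (L * B) $$ (i,j)" using ij L B by (auto simp: scalar_prod_def)
    finally show "(L' * B') $$ (i,j) = 1\<^sub>m k $$ (i,j)" by (simp add: LB)
  qed (use c in auto)
  from mat_mult_left_right_inverse[OF c(2,1) this] have "B' * L' = 1\<^sub>m k" .
  then have "(B' * L') $$ (d,d) = 1" using dk by simp
  moreover have "(B' * L') $$ (d,d) = 0"
    using dk by (auto simp: B'_def L'_def scalar_prod_def intro!: sum.neutral)
  ultimately show False by simp
qed

text \<open>The columns of \<open>B\<close> are a basis of \<open>W\<close>, and \<open>B * L\<close> is a projection onto \<open>W\<close>. A pair with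
  \<open>L * B = 1\<close> and \<open>k\<close> maximal does the job: a vector of \<open>W\<close> not fixed by \<open>B * L\<close> would give one
  more column of \<open>B\<close> and row of \<open>L\<close>.\<close>

lemma subspace_factorization:
  fixes W :: "'a :: field vec set"
  assumes "VectorSpace.subspace class_ring W (module_vec TYPE('a) d)"
  obtains k B L where "B \<in> carrier_mat d k" "L \<in> carrier_mat k d" "L * B = 1\<^sub>m k"
    "\<And>v. v \<in> carrier_vec k \<Longrightarrow> B *\<^sub>v v \<in> W" "\<And>w. w \<in> W \<Longrightarrow> B *\<^sub>v (L *\<^sub>v w) = w"
proof -
  have W: "W \<subseteq> carrier_vec d" "0\<^sub>v d \<in> W" "\<And>v w. v \<in> W \<Longrightarrow> w \<in> W \<Longrightarrow> v + w \<in> W"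
    "\<And>c v. v \<in> W \<Longrightarrow> c \<cdot>\<^sub>v v \<in> W"
    using assms unfolding subspace_vec_iff by auto
  define P where "P k \<longleftrightarrow> (\<exists>B L. B \<in> carrier_mat d k \<and> L \<in> carrier_mat k d \<and> L * B = 1\<^sub>m k \<and>
    (\<forall>v \<in> carrier_vec k. B *\<^sub>v v \<in> W))" for k
  have P0: "P 0"
    unfolding P_def
  proof (intro exI conjI ballI)
    show "(0\<^sub>m 0 d :: 'a mat) * 0\<^sub>m d 0 = 1\<^sub>m 0" by (rule eq_matI) auto
    fix v :: "'a vec" assume "v \<in> carrier_vec 0"
    then have "0\<^sub>m d 0 *\<^sub>v v = 0\<^sub>v d" by (intro eq_vecI) (auto simp: scalar_prod_def)
    then show "0\<^sub>m d 0 *\<^sub>v v \<in> W" using W(2) by simp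
  qed auto
  have bound: "P k \<Longrightarrow> k \<le> d" for k
    unfolding P_def using left_inverse_dim_le by blast
  define k where "k = (GREATEST k. P k)"
  have Pk: "P k" unfolding k_def by (rule GreatestI_nat[of P 0 d]) (use P0 bound in auto)
  have max: "\<not> P (Suc k)"
    using Greatest_le_nat[of P "Suc k" d] bound unfolding k_def by fastforce
  from Pk obtain B L where B: "B \<in> carrier_mat d k" and L: "L \<in> carrier_mat k d"
    and LB: "L * B = 1\<^sub>m k" and BW: "\<And>v. v \<in> carrier_vec k \<Longrightarrow> B *\<^sub>v v \<in> W"
    unfolding P_def by blast
  have "B *\<^sub>v (L *\<^sub>v w) = w" if w: "w \<in> W" for w
  proof (rule ccontr)
    assume ne: "B *\<^sub>v (L *\<^sub>v w) \<noteq> w"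
    have wc: "w \<in> carrier_vec d" using w W by auto
    have Lw: "L *\<^sub>v w \<in> carrier_vec k" using L wc by auto
    have BLw: "B *\<^sub>v (L *\<^sub>v w) \<in> carrier_vec d" using B Lw by auto
    \<comment> \<open>\<open>u\<close> is the part of \<open>w\<close> missed by
      \<open>B * L\<close>. It stays in \<open>W\<close>, and \<open>L\<close> kills it, so it is
      independent of the columns of \<open>B\<close>.\<close>
    define u where "u = w + (-1) \<cdot>\<^sub>v (B *\<^sub>v (L *\<^sub>v w))"
    have u: "u \<in> carrier_vec d" using wc BLw by (auto simp: u_def)
    have uW: "u \<in> W" unfolding u_def by (intro W(3,4) w BW Lw)
    have LBv: "L *\<^sub>v (B *\<^sub>v v) = v" if "v \<in> carrier_vec k" for v
      using assoc_mult_mat_vec[OF L B that] LB that by simp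
    have Lu: "L *\<^sub>v u = 0\<^sub>v k"
    proof -
      have "L *\<^sub>v u = L *\<^sub>v w + (-1) \<cdot>\<^sub>v (L *\<^sub>v (B *\<^sub>v (L *\<^sub>v w)))"
        unfolding u_def using L wc BLw by (simp add: mult_add_distrib_mat_vec mult_mat_vec)
      also have "\<dots> = 0\<^sub>v k"
      proof -
        have "z + (-1) \<cdot>\<^sub>v z = 0\<^sub>v k" if "z \<in> carrier_vec k" for z :: "'a vec"
          using that by (intro eq_vecI) auto
        then show ?thesis unfolding LBv[OF Lw] using Lw .
      qed
      finally show ?thesis .
    qed
    have vdiff: "(a + (-1) \<cdot>\<^sub>v b) $ i = a $ i - b $ i"
      if "a \<in> carrier_vec d" "b \<in> carrier_vec d" "i < d" for a b :: "'a vec" and i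
      using that by simp
    have "u \<noteq> 0\<^sub>v d"
    proof
      assume u0: "u = 0\<^sub>v d"
      have "B *\<^sub>v (L *\<^sub>v w) = w"
      proof (rule eq_vecI)
        fix i assume i: "i < dim_vec w"
        then have "u $ i = w $ i - (B *\<^sub>v (L *\<^sub>v w)) $ i"
          using vdiff[OF wc BLw, of i] wc unfolding u_def by simp
        then show "(B *\<^sub>v (L *\<^sub>v w)) $ i = w $ i" using u0 i wc by (auto simp del: index_mult_mat_vec)
      qed (use B BLw wc in auto)
      then show False using ne by simp
    qed
    then obtain p where p: "p < d" "u $ p \<noteq> 0"
      using eq_vecI[of "0\<^sub>v d" u] u by auto
    \<comment> \<open>The complementary projection: it kills the columns of \<open>B\<close> and
      fixes \<open>u\<close>.\<close>
    define M where "M = 1\<^sub>m d - B * L"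
    have M: "M \<in> carrier_mat d d" using B L by (auto simp: M_def)
    have MB: "M * B = 0\<^sub>m d k"
    proof -
      have "M * B = B - B * L * B" unfolding M_def using B L by (subst minus_mult_distrib_mat) auto
      also have "B * L * B = B" using B L LB by (subst assoc_mult_mat) auto
      finally show ?thesis using B by auto
    qed
    have Mu: "M *\<^sub>v u = u"
    proof -
      have "M *\<^sub>v u = u - B *\<^sub>v (L *\<^sub>v u)" unfolding M_def
        using B L u by (subst minus_mult_distrib_mat_vec[of _ d d]) auto
      also have "B *\<^sub>v (L *\<^sub>v u) = 0\<^sub>v d" unfolding Lu using B by auto
      finally show ?thesis using u by auto
    qed
    define B' where "B' = mat d (Suc k) (\<lambda>(i,j). if j < k then B $$ (i,j) else u $ i)"
    \<comment> \<open>The new row is row \<open>p\<close> of \<open>M\<close> divided by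
      \<open>u $ p\<close>. It gives 0 on the columns of \<open>B\<close> because
      \<open>M * B\<close> is zero, and 1 on \<open>u\<close> because \<open>M\<close> fixes
      \<open>u\<close>.\<close>
    define L' where "L' = mat (Suc k) d (\<lambda>(i,j). if i < k then L $$ (i,j) else M $$ (p,j) / u $ p)"
    have c: "B' \<in> carrier_mat d (Suc k)" "L' \<in> carrier_mat (Suc k) d" by (auto simp: B'_def L'_def)
    have "L' * B' = 1\<^sub>m (Suc k)"
    proof (rule eq_matI)
      fix i j assume ij: "i < dim_row (1\<^sub>m (Suc k) :: 'a mat)" "j < dim_col (1\<^sub>m (Suc k) :: 'a mat)"
      have e: "(L' * B') $$ (i,j) = (\<Sum>l=0..<d. L' $$ (i,l) * B' $$ (l,j))"
        using ij c by (auto simp: scalar_prod_def)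
      consider "i < k" "j < k" | "i < k" "j = k" | "i = k" "j < k" | "i = k" "j = k"
        using ij by (auto simp: less_Suc_eq)
      then show "(L' * B') $$ (i,j) = 1\<^sub>m (Suc k) $$ (i,j)"
      proof cases
        case 1
        then have "(L' * B') $$ (i,j) = (L * B) $$ (i,j)"
          unfolding e using B L by (auto simp: B'_def L'_def scalar_prod_def)
        then show ?thesis using 1 by (simp add: LB)
      next
        case 2
        then have "(L' * B') $$ (i,j) = (L *\<^sub>v u) $ i"
          unfolding e using L u by (auto simp: B'_def L'_def scalar_prod_def)
        then show ?thesis using 2 by (simp add: Lu)
      next
        case 3
        then have "(L' * B') $$ (i,j) = (M * B) $$ (p,j) / u $ p"
          unfolding e using B M p by (auto simp: B'_def L'_def scalar_prod_def sum_divide_distrib)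
        then show ?thesis using 3 p by (simp add: MB)
      next
        case 4
        then have "(L' * B') $$ (i,j) = (M *\<^sub>v u) $ p / u $ p"
          unfolding e using u M p by (auto simp: B'_def L'_def scalar_prod_def sum_divide_distrib)
        then show ?thesis using 4 p by (simp add: Mu)
      qed
    qed (use c in auto)
    moreover have "B' *\<^sub>v v \<in> W" if v: "v \<in> carrier_vec (Suc k)" for v
    proof -
      let ?v = "vec k (\<lambda>i. v $ i)"
      have "B' *\<^sub>v v = B *\<^sub>v ?v + (v $ k) \<cdot>\<^sub>v u"
        using B u v by (intro eq_vecI) (auto simp: B'_def scalar_prod_def mult.commute)
      then show ?thesis using W(3,4) BW[of ?v] uW by simp
    qed
    ultimately have "P (Suc k)" unfolding P_def using c by blast
    then show False using max by simp
  qed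
  then show thesis using that[OF B L LB] BW by blast
qed

lemma mat_eq_if_mult_vec_eq:
  fixes A B :: "'a :: field mat"
  assumes A: "A \<in> carrier_mat n m" and B: "B \<in> carrier_mat n m"
    and eq: "\<And>v. v \<in> carrier_vec m \<Longrightarrow> A *\<^sub>v v = B *\<^sub>v v"
  shows "A = B"
proof (rule eq_matI)
  fix i j assume ij: "i < dim_row B" "j < dim_col B"
  have "A *\<^sub>v unit_vec m j = B *\<^sub>v unit_vec m j" by (rule eq) simp
  then have "(A *\<^sub>v unit_vec m j) $ i = (B *\<^sub>v unit_vec m j) $ i" by simp
  then show "A $$ (i,j) = B $$ (i,j)" using A B ij by simp
qed (use A B in auto)

lemma zero_mult_mat_vec:
  assumes "v \<in> carrier_vec m"
  shows "0\<^sub>m n m *\<^sub>v v = (0\<^sub>v n :: 'a :: semiring_0 vec)"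
  using assms by (intro eq_vecI) auto

lemma mat_kernel_subspace:
  fixes T :: "'a :: field mat"
  assumes T: "T \<in> carrier_mat e d"
  shows "VectorSpace.subspace class_ring {v \<in> carrier_vec d. T *\<^sub>v v = 0\<^sub>v e} (module_vec TYPE('a) d)"
  unfolding subspace_vec_iff using T by (auto simp: mult_add_distrib_mat_vec mult_mat_vec)

lemma mat_range_subspace:
  fixes T :: "'a :: field mat"
  assumes T: "T \<in> carrier_mat e d"
  shows "VectorSpace.subspace class_ring {T *\<^sub>v v |v. v \<in> carrier_vec d} (module_vec TYPE('a) e)"
  unfolding subspace_vec_iff
proof (intro conjI ballI allI)
  show "0\<^sub>v e \<in> {T *\<^sub>v v |v. v \<in> carrier_vec d}"
    using T by (auto intro!: exI[of _ "0\<^sub>v d"])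
next
  fix v w assume "v \<in> {T *\<^sub>v v |v. v \<in> carrier_vec d}" "w \<in> {T *\<^sub>v v |v. v \<in> carrier_vec d}"
  then obtain a b where "a \<in> carrier_vec d" "b \<in> carrier_vec d" "v = T *\<^sub>v a" "w = T *\<^sub>v b" by auto
  then show "v + w \<in> {T *\<^sub>v v |v. v \<in> carrier_vec d}"
    using T by (auto intro!: exI[of _ "a + b"] simp: mult_add_distrib_mat_vec)
next
  fix c v assume "v \<in> {T *\<^sub>v v |v. v \<in> carrier_vec d}"
  then obtain a where "a \<in> carrier_vec d" "v = T *\<^sub>v a" by auto
  then show "c \<cdot>\<^sub>v v \<in> {T *\<^sub>v v |v. v \<in> carrier_vec d}"
    using T by (auto intro!: exI[of _ "c \<cdot>\<^sub>v a"] simp: mult_mat_vec)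
qed (use T in auto)

section \<open>Schur's lemma and composition series\<close>

context group
begin

text \<open>Invertibility is automatic once the identity goes to the identity matrix, since
  \<open>\<rho> (inv g)\<close> inverts \<open>\<rho> g\<close>. That value has to be listed because
  multiplicativity alone also admits the zero map.\<close>

lemma is_rep_iff:
  "is_rep G d \<rho> \<longleftrightarrow> (\<forall>g \<in> carrier G. \<rho> g \<in> carrier_mat d d) \<and> \<rho> \<one> = 1\<^sub>m d \<and>
     (\<forall>g \<in> carrier G. \<forall>h \<in> carrier G. \<rho> (g \<otimes> h) = \<rho> g * \<rho> h)"
proof
  let ?R = "ring_mat TYPE(complex) d ()"
  interpret R: ring ?R by (rule ring_mat)
  interpret U: group "units_of ?R" by (rule R.units_group)
  assume r: "is_rep G d \<rho>"
  then have h: "\<rho> \<in> hom G (units_of ?R)" by (simp add: is_rep_def)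
  then interpret group_hom G "units_of ?R" \<rho> by unfold_locales
  have "\<rho> \<one> = 1\<^sub>m d" using hom_one by (simp add: units_of_def ring_mat_simps)
  moreover have "\<rho> g \<in> carrier_mat d d" if "g \<in> carrier G" for g
    using hom_closed[OF that] by (simp add: units_of_def Units_def ring_mat_simps)
  moreover have "\<rho> (g \<otimes> k) = \<rho> g * \<rho> k" if "g \<in> carrier G" "k \<in> carrier G" for g k
    using hom_mult[OF that] by (simp add: units_of_def ring_mat_simps)
  ultimately show "(\<forall>g \<in> carrier G. \<rho> g \<in> carrier_mat d d) \<and> \<rho> \<one> = 1\<^sub>m d \<and>
     (\<forall>g \<in> carrier G. \<forall>h \<in> carrier G. \<rho> (g \<otimes> h) = \<rho> g * \<rho> h)" by blast
next
  let ?R = "ring_mat TYPE(complex) d ()"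
  assume r: "(\<forall>g \<in> carrier G. \<rho> g \<in> carrier_mat d d) \<and> \<rho> \<one> = 1\<^sub>m d \<and>
     (\<forall>g \<in> carrier G. \<forall>h \<in> carrier G. \<rho> (g \<otimes> h) = \<rho> g * \<rho> h)"
  have "\<rho> g \<in> Units ?R" if g: "g \<in> carrier G" for g
  proof -
    have "\<rho> (inv g) * \<rho> g = 1\<^sub>m d" "\<rho> g * \<rho> (inv g) = 1\<^sub>m d"
      using r g by (metis inv_closed l_inv, metis inv_closed r_inv)
    then show ?thesis using r g inv_closed[OF g]
      unfolding Units_def ring_mat_simps by blast
  qed
  then show "is_rep G d \<rho>" using r
    by (auto simp: is_rep_def hom_def units_of_def ring_mat_simps)
qed

lemma is_repD:
  assumes "is_rep G d \<rho>"
  shows "\<rho> \<one> = 1\<^sub>m d" and "g \<in> carrier G \<Longrightarrow> \<rho> g \<in> carrier_mat d d"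
    and "g \<in> carrier G \<Longrightarrow> h \<in> carrier G \<Longrightarrow> \<rho> (g \<otimes> h) = \<rho> g * \<rho> h"
  using assms unfolding is_rep_iff by auto

lemma irreducible_repD:
  assumes "irreducible_rep G d \<rho>"
  shows "is_rep G d \<rho>" and "0 < d"
    and "VectorSpace.subspace class_ring W (module_vec TYPE(complex) d) \<Longrightarrow>
      (\<And>g w. g \<in> carrier G \<Longrightarrow> w \<in> W \<Longrightarrow> \<rho> g *\<^sub>v w \<in> W) \<Longrightarrow> W = {0\<^sub>v d} \<or> W = carrier_vec d"
  using assms unfolding irreducible_rep_def by blast+

text \<open>First half of Schur's lemma: the kernel of \<open>T\<close> is invariant under the
  irreducible \<open>\<rho>\<close>, and it is not everything because \<open>T\<close> is
  nonzero.\<close>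

lemma intertwiner_injective:
  assumes irr: "irreducible_rep G d \<rho>" and \<sigma>: "is_rep G e \<sigma>" and T: "T \<in> carrier_mat e d"
    and comm: "\<And>g. g \<in> carrier G \<Longrightarrow> \<sigma> g * T = T * \<rho> g" and "T \<noteq> 0\<^sub>m e d"
    and v: "v \<in> carrier_vec d" "T *\<^sub>v v = 0\<^sub>v e"
  shows "v = 0\<^sub>v d"
proof -
  note \<rho> = irreducible_repD(1)[OF irr]
  let ?W = "{v \<in> carrier_vec d. T *\<^sub>v v = 0\<^sub>v e}"
  have "?W = {0\<^sub>v d} \<or> ?W = carrier_vec d"
  proof (rule irreducible_repD(3)[OF irr mat_kernel_subspace[OF T]])
    fix g w assume g: "g \<in> carrier G" and w: "w \<in> ?W"
    have "T *\<^sub>v (\<rho> g *\<^sub>v w) = (T * \<rho> g) *\<^sub>v w"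
      using T is_repD(2)[OF \<rho> g] w by auto
    also have "\<dots> = \<sigma> g *\<^sub>v (T *\<^sub>v w)"
      unfolding comm[OF g, symmetric] using T is_repD(2)[OF \<sigma> g] w by auto
    also have "\<dots> = 0\<^sub>v e" using w is_repD(2)[OF \<sigma> g] by auto
    finally show "\<rho> g *\<^sub>v w \<in> ?W" using is_repD(2)[OF \<rho> g] w by auto
  qed
  moreover have "?W \<noteq> carrier_vec d"
  proof
    assume "?W = carrier_vec d"
    then have "T *\<^sub>v v = 0\<^sub>v e" if "v \<in> carrier_vec d" for v using that by blast
    then have "T *\<^sub>v v = 0\<^sub>m e d *\<^sub>v v" if "v \<in> carrier_vec d" for v
      using that by (simp add: zero_mult_mat_vec)
    then have "T = 0\<^sub>m e d" by (intro mat_eq_if_mult_vec_eq[OF T]) auto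
    then show False using \<open>T \<noteq> 0\<^sub>m e d\<close> by simp
  qed
  ultimately show ?thesis using v by blast
qed

text \<open>Second half of Schur's lemma: the range of \<open>T\<close> is invariant under the
  irreducible \<open>\<sigma>\<close>, and it is not zero because \<open>T\<close> is
  nonzero.\<close>

lemma intertwiner_surjective:
  assumes \<rho>: "is_rep G d \<rho>" and irr: "irreducible_rep G e \<sigma>" and T: "T \<in> carrier_mat e d"
    and comm: "\<And>g. g \<in> carrier G \<Longrightarrow> \<sigma> g * T = T * \<rho> g" and "T \<noteq> 0\<^sub>m e d"
    and w: "w \<in> carrier_vec e"
  obtains v where "v \<in> carrier_vec d" "T *\<^sub>v v = w"
proof -
  note \<sigma> = irreducible_repD(1)[OF irr]
  let ?W = "{T *\<^sub>v v |v. v \<in> carrier_vec d}"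
  have "?W = {0\<^sub>v e} \<or> ?W = carrier_vec e"
  proof (rule irreducible_repD(3)[OF irr mat_range_subspace[OF T]])
    fix g w assume g: "g \<in> carrier G" and w: "w \<in> ?W"
    then obtain v where v: "v \<in> carrier_vec d" "w = T *\<^sub>v v" by auto
    have "\<sigma> g *\<^sub>v w = (\<sigma> g * T) *\<^sub>v v"
      using T is_repD(2)[OF \<sigma> g] v by auto
    also have "\<dots> = T *\<^sub>v (\<rho> g *\<^sub>v v)"
      unfolding comm[OF g] using T is_repD(2)[OF \<rho> g] v by auto
    finally show "\<sigma> g *\<^sub>v w \<in> ?W" using is_repD(2)[OF \<rho> g] v by auto
  qed
  moreover have "?W \<noteq> {0\<^sub>v e}"
  proof
    assume "?W = {0\<^sub>v e}"
    then have "T *\<^sub>v v = 0\<^sub>v e" if "v \<in> carrier_vec d" for v using that by blast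
    then have "T *\<^sub>v v = 0\<^sub>m e d *\<^sub>v v" if "v \<in> carrier_vec d" for v
      using that by (simp add: zero_mult_mat_vec)
    then have "T = 0\<^sub>m e d" by (intro mat_eq_if_mult_vec_eq[OF T]) auto
    then show False using \<open>T \<noteq> 0\<^sub>m e d\<close> by simp
  qed
  ultimately have "w \<in> ?W" using w by simp
  then show thesis using that by auto
qed

text \<open>A nonzero intertwiner between irreducible representations is invertible, so the two
  representations are similar. The inverse \<open>S\<close> is assembled columnwise from preimages
  of the unit vectors.\<close>

lemma intertwiner_trace_eq:
  assumes \<rho>: "irreducible_rep G d \<rho>" and \<sigma>: "irreducible_rep G e \<sigma>" and T: "T \<in> carrier_mat e d"
    and comm: "\<And>g. g \<in> carrier G \<Longrightarrow> \<sigma> g * T = T * \<rho> g" and T0: "T \<noteq> 0\<^sub>m e d"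
    and g: "g \<in> carrier G"
  shows "mat_trace (\<rho> g) = mat_trace (\<sigma> g)"
proof -
  note r = is_repD[OF irreducible_repD(1)[OF \<rho>]] and s = is_repD[OF irreducible_repD(1)[OF \<sigma>]]
  have "\<forall>j. \<exists>v. v \<in> carrier_vec d \<and> T *\<^sub>v v = unit_vec e j"
    using intertwiner_surjective[OF irreducible_repD(1)[OF \<rho>] \<sigma> T comm T0] unit_vec_carrier by metis
  from choice[OF this] obtain f where
    f: "\<And>j. f j \<in> carrier_vec d" "\<And>j. T *\<^sub>v f j = unit_vec e j" by blast
  define S where "S = mat d e (\<lambda>(i,j). f j $ i)"
  have S: "S \<in> carrier_mat d e" by (simp add: S_def)
  have TS: "T * S = 1\<^sub>m e"
  proof (rule eq_matI)
    fix i j assume ij: "i < dim_row (1\<^sub>m e :: complex mat)" "j < dim_col (1\<^sub>m e :: complex mat)"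
    have "col S j = f j" using f(1)[of j] ij by (auto simp: S_def)
    then have "(T * S) $$ (i,j) = (T *\<^sub>v f j) $ i" using T S ij by auto
    then show "(T * S) $$ (i,j) = 1\<^sub>m e $$ (i,j)" using ij by (simp only: f(2)) (simp add: unit_vec_def)
  qed (use T S in auto)
  \<comment> \<open>Here d = e is not yet known, so a right inverse is not automatically a left one.
    Instead \<open>T\<close> kills the difference of \<open>S *\<^sub>v (T *\<^sub>v v)\<close> and
    \<open>v\<close>, and \<open>T\<close> is injective.\<close>
  have ST: "S * T = 1\<^sub>m d"
  proof (rule mat_eq_if_mult_vec_eq)
    fix v :: "complex vec" assume v: "v \<in> carrier_vec d"
    have STv: "S *\<^sub>v (T *\<^sub>v v) \<in> carrier_vec d" using S T v by auto
    have "T *\<^sub>v (S *\<^sub>v (T *\<^sub>v v)) = (T * S) *\<^sub>v (T *\<^sub>v v)"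
      using T S v by (subst assoc_mult_mat_vec[of T e d S e]) auto
    also have "\<dots> = T *\<^sub>v v" using TS T v by auto
    finally have "T *\<^sub>v (S *\<^sub>v (T *\<^sub>v v) - v) = 0\<^sub>v e"
      using T STv v by (subst mult_minus_distrib_mat_vec[of T e d]) auto
    then have z: "S *\<^sub>v (T *\<^sub>v v) - v = 0\<^sub>v d"
      using STv v by (intro intertwiner_injective[OF \<rho> irreducible_repD(1)[OF \<sigma>] T comm T0]) auto
    have "S *\<^sub>v (T *\<^sub>v v) = v"
    proof (rule eq_vecI)
      fix i assume i: "i < dim_vec v"
      then have "(S *\<^sub>v (T *\<^sub>v v) - v) $ i = (S *\<^sub>v (T *\<^sub>v v)) $ i - v $ i" by (rule index_minus_vec(1))
      moreover have "(S *\<^sub>v (T *\<^sub>v v) - v) $ i = 0" unfolding z using i v by auto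
      ultimately show "(S *\<^sub>v (T *\<^sub>v v)) $ i = v $ i" by (metis right_minus_eq)
    qed (use S STv v in auto)
    then show "S * T *\<^sub>v v = 1\<^sub>m d *\<^sub>v v" using S T v by auto
  qed (use S T in auto)
  have "mat_trace (\<rho> g) = mat_trace (S * T * \<rho> g)" using ST r(2)[OF g] by simp
  also have "S * T * \<rho> g = S * (T * \<rho> g)" using S T r(2)[OF g] by (rule assoc_mult_mat)
  also have "\<dots> = S * (\<sigma> g * T)" by (simp only: comm[OF g])
  also have "mat_trace \<dots> = mat_trace (\<sigma> g * T * S)"
    using S T s(2)[OF g] by (intro mat_trace_mult_comm) auto
  also have "\<sigma> g * T * S = \<sigma> g * (T * S)" using s(2)[OF g] T S by (rule assoc_mult_mat)
  finally show ?thesis using TS s(2)[OF g] by simp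
qed

text \<open>Over the complex numbers \<open>T\<close> has an eigenvalue k. Then \<open>T\<close>
  minus k times the identity is an intertwiner that kills a nonzero vector, hence zero; taking
  traces determines k.\<close>

lemma schur_scalar:
  assumes \<rho>: "irreducible_rep G d \<rho>" and T: "T \<in> carrier_mat d d"
    and comm: "\<And>g. g \<in> carrier G \<Longrightarrow> \<rho> g * T = T * \<rho> g"
  shows "T = (mat_trace T / of_nat d) \<cdot>\<^sub>m 1\<^sub>m d"
proof -
  have d: "0 < d" by (rule irreducible_repD(2)[OF \<rho>])
  note r = is_repD[OF irreducible_repD(1)[OF \<rho>]]
  obtain k where "eigenvalue T k" using spectrum_non_empty[OF T d] by (auto simp: spectrum_def)
  then obtain v where v: "v \<in> carrier_vec d" "v \<noteq> 0\<^sub>v d" "T *\<^sub>v v = k \<cdot>\<^sub>v v"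
    using T by (auto simp: eigenvalue_def eigenvector_def)
  define M where "M = T - k \<cdot>\<^sub>m 1\<^sub>m d"
  have M: "M \<in> carrier_mat d d" using T by (simp add: M_def minus_carrier_mat)
  have "\<rho> g * M = M * \<rho> g" if g: "g \<in> carrier G" for g
  proof -
    have "\<rho> g * M = \<rho> g * T - k \<cdot>\<^sub>m \<rho> g" unfolding M_def
      using T r(2)[OF g] by (simp add: mult_minus_distrib_mat mult_smult_distrib[of _ d d _ d])
    also have "\<dots> = M * \<rho> g" unfolding M_def comm[OF g]
      using T r(2)[OF g] by (simp add: minus_mult_distrib_mat mult_smult_assoc_mat[of _ d d _ d])
    finally show ?thesis .
  qed
  moreover have "M *\<^sub>v v = 0\<^sub>v d"
  proof -
    have "M *\<^sub>v v = T *\<^sub>v v - (k \<cdot>\<^sub>m 1\<^sub>m d) *\<^sub>v v"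
      unfolding M_def using T v by (intro minus_mult_distrib_mat_vec) auto
    also have "(k \<cdot>\<^sub>m 1\<^sub>m d) *\<^sub>v v = k \<cdot>\<^sub>v v" using v by (intro eq_vecI) auto
    finally show ?thesis using v by simp
  qed
  ultimately have "M = 0\<^sub>m d d"
    using intertwiner_injective[OF \<rho> irreducible_repD(1)[OF \<rho>] M] v by blast
  have Tk: "T = k \<cdot>\<^sub>m 1\<^sub>m d"
  proof (rule eq_matI)
    fix i j assume ij: "i < dim_row (k \<cdot>\<^sub>m 1\<^sub>m d)" "j < dim_col (k \<cdot>\<^sub>m 1\<^sub>m d)"
    then have "M $$ (i,j) = T $$ (i,j) - (k \<cdot>\<^sub>m 1\<^sub>m d) $$ (i,j)" using T by (simp add: M_def minus_carrier_mat)
    moreover have "M $$ (i,j) = 0" using \<open>M = 0\<^sub>m d d\<close> ij by simp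
    ultimately show "T $$ (i,j) = (k \<cdot>\<^sub>m 1\<^sub>m d) $$ (i,j)" by simp
  qed (use T in auto)
  have "mat_trace T = k * of_nat d" unfolding Tk by (simp add: mat_trace_smult[of _ d] mat_trace_one)
  then show ?thesis using Tk d by simp
qed

text \<open>A composition series suffices here: traces only see the diagonal blocks, so complete
  reducibility is not needed.\<close>

lemma character_splits_at_subspace:
  assumes \<rho>: "is_rep G d \<rho>" and W: "VectorSpace.subspace class_ring W (module_vec TYPE(complex) d)"
    and inv: "\<And>g w. g \<in> carrier G \<Longrightarrow> w \<in> W \<Longrightarrow> \<rho> g *\<^sub>v w \<in> W"
    and W0: "W \<noteq> {0\<^sub>v d}" and W1: "W \<noteq> carrier_vec d"
  obtains k k' \<rho>1 \<rho>2 where "k < d" "k' < d" "is_rep G k \<rho>1" "is_rep G k' \<rho>2"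
    "\<And>g. g \<in> carrier G \<Longrightarrow> mat_trace (\<rho> g) = mat_trace (\<rho>1 g) + mat_trace (\<rho>2 g)"
proof -
  note r = is_repD[OF \<rho>]
  obtain k B L where B: "B \<in> carrier_mat d k" and L: "L \<in> carrier_mat k d" and LB: "L * B = 1\<^sub>m k"
    and BW: "\<And>v. v \<in> carrier_vec k \<Longrightarrow> B *\<^sub>v v \<in> W" and BL: "\<And>w. w \<in> W \<Longrightarrow> B *\<^sub>v (L *\<^sub>v w) = w"
    by (rule subspace_factorization[OF W]) (rule that)
  have Wc: "W \<subseteq> carrier_vec d" and W0': "0\<^sub>v d \<in> W" using W by (auto simp: subspace_vec_iff)
  have P: "B * L \<in> carrier_mat d d" using B L by simp
  define M where "M = 1\<^sub>m d - B * L"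
  have M: "M \<in> carrier_mat d d" using P by (simp add: M_def minus_carrier_mat)
  have I: "B * L + M = 1\<^sub>m d" using B L by (intro eq_matI) (auto simp: M_def)
  \<comment> \<open>The columns of \<open>S\<close> span the kernel of the projection
    \<open>B * L\<close>, a vector space complement of \<open>W\<close> that need not be
    invariant.\<close>
  obtain k' S Q0 where S: "S \<in> carrier_mat d k'" and Q0: "Q0 \<in> carrier_mat k' d"
    and Q0S: "Q0 * S = 1\<^sub>m k'"
    and SK: "\<And>v. v \<in> carrier_vec k' \<Longrightarrow> S *\<^sub>v v \<in> {v \<in> carrier_vec d. (B * L) *\<^sub>v v = 0\<^sub>v d}"
    and SQ0: "\<And>w. w \<in> {v \<in> carrier_vec d. (B * L) *\<^sub>v v = 0\<^sub>v d} \<Longrightarrow> S *\<^sub>v (Q0 *\<^sub>v w) = w"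
    by (rule subspace_factorization[OF mat_kernel_subspace[OF P]]) (rule that)
  \<comment> \<open>\<open>Q0\<close> inverts \<open>S\<close> from the left but may be nonzero on
    \<open>W\<close>. Composed with \<open>M\<close> it vanishes on \<open>W\<close>, and
    \<open>S * Q = M\<close>. So \<open>B\<close> and \<open>S\<close> side by side form a change of
    basis whose inverse has the row blocks \<open>L\<close> and \<open>Q\<close>.\<close>
  define Q where "Q = Q0 * M"
  have Q: "Q \<in> carrier_mat k' d" using Q0 M by (simp add: Q_def)
  have BLB: "B * L * B = B" using B L LB by (subst assoc_mult_mat[of _ d k _ d _ k]) auto
  have PM: "(B * L) * M = 0\<^sub>m d d"
  proof -
    have "(B * L) * M = (B * L) * 1\<^sub>m d - (B * L) * (B * L)" unfolding M_def
      using P by (intro mult_minus_distrib_mat) auto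
    also have "(B * L) * (B * L) = B * L * B * L"
      using B L by (subst assoc_mult_mat[of "B * L" d d B k L d]) auto
    finally show ?thesis using P BLB by (simp add: right_mult_one_mat[OF P])
  qed
  have MB: "M * B = 0\<^sub>m d k"
  proof -
    have "M * B = 1\<^sub>m d * B - B * L * B" unfolding M_def using B P by (intro minus_mult_distrib_mat) auto
    then show ?thesis using B BLB by simp
  qed
  have PS: "(B * L) * S = 0\<^sub>m d k'"
  proof (rule mat_eq_if_mult_vec_eq)
    fix v :: "complex vec" assume v: "v \<in> carrier_vec k'"
    have "((B * L) * S) *\<^sub>v v = (B * L) *\<^sub>v (S *\<^sub>v v)" using P S v by (rule assoc_mult_mat_vec)
    also have "\<dots> = 0\<^sub>v d" using SK[OF v] by blast
    finally show "((B * L) * S) *\<^sub>v v = 0\<^sub>m d k' *\<^sub>v v" by (simp add: zero_mult_mat_vec[OF v])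
  qed (use P S in auto)
  have SQ: "S * Q = M"
  proof (rule mat_eq_if_mult_vec_eq)
    fix v :: "complex vec" assume v: "v \<in> carrier_vec d"
    have Mv: "M *\<^sub>v v \<in> carrier_vec d" using M v by (rule mult_mat_vec_carrier)
    have "(B * L) *\<^sub>v (M *\<^sub>v v) = ((B * L) * M) *\<^sub>v v"
      using P M v by (rule assoc_mult_mat_vec[symmetric])
    also have "\<dots> = 0\<^sub>v d" unfolding PM by (rule zero_mult_mat_vec[OF v])
    finally have "S *\<^sub>v (Q0 *\<^sub>v (M *\<^sub>v v)) = M *\<^sub>v v" using Mv by (intro SQ0) blast
    also have "Q0 *\<^sub>v (M *\<^sub>v v) = Q *\<^sub>v v" unfolding Q_def
      using Q0 M v by (rule assoc_mult_mat_vec[symmetric])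
    also have "S *\<^sub>v (Q *\<^sub>v v) = (S * Q) *\<^sub>v v" using S Q v by (rule assoc_mult_mat_vec[symmetric])
    finally show "(S * Q) *\<^sub>v v = M *\<^sub>v v" .
  qed (use S Q M in auto)
  have QS: "Q * S = 1\<^sub>m k'"
  proof -
    have "M * S = 1\<^sub>m d * S - (B * L) * S" unfolding M_def
      using P S by (intro minus_mult_distrib_mat) auto
    then have MS: "M * S = S" using PS S by (intro eq_matI) auto
    have "Q * S = Q0 * (M * S)" unfolding Q_def using Q0 M S by (rule assoc_mult_mat)
    then show ?thesis using Q0S MS by simp
  qed
  have QB: "Q * B = 0\<^sub>m k' k"
  proof -
    have "Q * B = Q0 * (M * B)" unfolding Q_def using Q0 M B by (rule assoc_mult_mat)
    then show ?thesis using MB Q0 by simp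
  qed
  \<comment> \<open>Invariance of \<open>W\<close> as a matrix identity: \<open>\<rho> g\<close>
    maps the columns of \<open>B\<close> into \<open>W\<close>, where \<open>B * L\<close> acts as
    the identity.\<close>
  have inv': "B * (L * (\<rho> g * B)) = \<rho> g * B" if g: "g \<in> carrier G" for g
  proof (rule mat_eq_if_mult_vec_eq)
    note rg = r(2)[OF g]
    have rB: "\<rho> g * B \<in> carrier_mat d k" using rg B by simp
    fix v :: "complex vec" assume v: "v \<in> carrier_vec k"
    have "(\<rho> g * B) *\<^sub>v v = \<rho> g *\<^sub>v (B *\<^sub>v v)" using rg B v by (rule assoc_mult_mat_vec)
    then have "(\<rho> g * B) *\<^sub>v v \<in> W" using inv[OF g BW[OF v]] by simp
    then have "B *\<^sub>v (L *\<^sub>v ((\<rho> g * B) *\<^sub>v v)) = (\<rho> g * B) *\<^sub>v v" by (rule BL)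
    moreover have "(B * (L * (\<rho> g * B))) *\<^sub>v v = B *\<^sub>v ((L * (\<rho> g * B)) *\<^sub>v v)"
      using B L rB v by (intro assoc_mult_mat_vec) auto
    moreover have "(L * (\<rho> g * B)) *\<^sub>v v = L *\<^sub>v ((\<rho> g * B) *\<^sub>v v)"
      using L rB v by (rule assoc_mult_mat_vec)
    ultimately show "(B * (L * (\<rho> g * B))) *\<^sub>v v = (\<rho> g * B) *\<^sub>v v" by simp
  qed (use B L r(2)[OF g] in auto)
  \<comment> \<open>The diagonal blocks in the new basis: the action on \<open>W\<close>, and the
    action on the quotient by \<open>W\<close>.\<close>
  define \<rho>1 where "\<rho>1 g = L * (\<rho> g * B)" for g
  define \<rho>2 where "\<rho>2 g = Q * (\<rho> g * S)" for g
  have rep1: "is_rep G k \<rho>1"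
    unfolding is_rep_iff
  proof (intro conjI ballI)
    show "\<rho>1 \<one> = 1\<^sub>m k" using r(1) B LB by (simp add: \<rho>1_def)
    fix g assume g: "g \<in> carrier G"
    show "\<rho>1 g \<in> carrier_mat k k" using r(2)[OF g] B L by (auto simp: \<rho>1_def)
    fix h assume h: "h \<in> carrier G"
    note rg = r(2)[OF g] and rh = r(2)[OF h]
    have "\<rho>1 g * \<rho>1 h = L * ((\<rho> g * B) * (L * (\<rho> h * B)))"
      unfolding \<rho>1_def using L B rg rh by (intro assoc_mult_mat[of _ k d _ k _ k]) auto
    also have "(\<rho> g * B) * (L * (\<rho> h * B)) = \<rho> g * (B * (L * (\<rho> h * B)))"
      using L B rg rh by (intro assoc_mult_mat[of _ d d _ k _ k]) auto
    also have "\<dots> = \<rho> g * (\<rho> h * B)" by (simp only: inv'[OF h])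
    also have "\<dots> = (\<rho> g * \<rho> h) * B" using rg rh B by (rule assoc_mult_mat[symmetric])
    also have "\<dots> = \<rho> (g \<otimes> h) * B" by (simp only: r(3)[OF g h])
    finally show "\<rho>1 (g \<otimes> h) = \<rho>1 g * \<rho>1 h" by (simp only: \<rho>1_def)
  qed
  have rep2: "is_rep G k' \<rho>2"
    unfolding is_rep_iff
  proof (intro conjI ballI)
    show "\<rho>2 \<one> = 1\<^sub>m k'" using r(1) S QS by (simp add: \<rho>2_def)
    fix g assume g: "g \<in> carrier G"
    show "\<rho>2 g \<in> carrier_mat k' k'" using r(2)[OF g] S Q by (auto simp: \<rho>2_def)
    fix h assume h: "h \<in> carrier G"
    note rg = r(2)[OF g] and rh = r(2)[OF h]
    have "Q * (\<rho> g * B) = Q * (B * (L * (\<rho> g * B)))" by (simp only: inv'[OF g])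
    also have "\<dots> = (Q * B) * (L * (\<rho> g * B))"
      using Q B L rg by (intro assoc_mult_mat[symmetric, of _ k' d _ k _ k]) auto
    also have "\<dots> = 0\<^sub>m k' k" unfolding QB using L rg B by (intro left_mult_zero_mat) auto
    finally have QrB: "Q * (\<rho> g * B) = 0\<^sub>m k' k" .
    define X where "X = \<rho> h * S"
    have X: "X \<in> carrier_mat d k'" using rh S by (simp add: X_def)
    \<comment> \<open>The block \<open>Q * \<rho> g * B\<close> below the diagonal vanishes because
      \<open>\<rho> g\<close> preserves \<open>W\<close>. Hence the factor \<open>S * Q = M\<close>
      between \<open>\<rho> g\<close> and \<open>\<rho> h\<close> can be replaced by the identity,
      which makes \<open>\<rho>2\<close> multiplicative.\<close>
    have zero: "(Q * \<rho> g) * ((B * L) * X) = 0\<^sub>m k' k'"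
    proof -
      have "(Q * \<rho> g) * ((B * L) * X) = (Q * \<rho> g) * (B * (L * X))"
        using B L X by (subst assoc_mult_mat[of B d k L d X k']) auto
      also have "\<dots> = (Q * \<rho> g * B) * (L * X)"
        using Q rg B L X by (intro assoc_mult_mat[symmetric, of _ k' d _ k _ k']) auto
      also have "Q * \<rho> g * B = 0\<^sub>m k' k"
        using QrB assoc_mult_mat[OF Q rg B] by simp
      finally show ?thesis using L X by (simp add: left_mult_zero_mat[of "L * X" k k'])
    qed
    have "\<rho>2 g * \<rho>2 h = (Q * \<rho> g * S) * (Q * X)"
      unfolding \<rho>2_def X_def using assoc_mult_mat[OF Q rg S] by simp
    also have "\<dots> = (Q * \<rho> g) * (S * (Q * X))"
      using Q rg S X by (intro assoc_mult_mat[of _ k' d _ k' _ k']) auto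
    also have "S * (Q * X) = M * X" using assoc_mult_mat[OF S Q X] SQ by simp
    also have "(Q * \<rho> g) * (M * X) = (Q * \<rho> g) * ((B * L) * X) + (Q * \<rho> g) * (M * X)"
      unfolding zero using Q rg M X by (intro left_add_zero_mat[symmetric]) auto
    also have "\<dots> = (Q * \<rho> g) * ((B * L) * X + M * X)"
      using Q rg P M X by (intro mult_add_distrib_mat[symmetric, of _ k' d _ k']) auto
    also have "(B * L) * X + M * X = (B * L + M) * X"
      using P M X by (rule add_mult_distrib_mat[symmetric])
    also have "\<dots> = X" unfolding I using X by simp
    also have "(Q * \<rho> g) * X = Q * (\<rho> g * X)" using Q rg X by (rule assoc_mult_mat)
    also have "\<rho> g * X = \<rho> (g \<otimes> h) * S"
      unfolding X_def r(3)[OF g h] using rg rh S by (rule assoc_mult_mat[symmetric])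
    finally show "\<rho>2 (g \<otimes> h) = \<rho>2 g * \<rho>2 h" by (simp only: \<rho>2_def)
  qed
  have tr: "mat_trace (\<rho> g) = mat_trace (\<rho>1 g) + mat_trace (\<rho>2 g)" if g: "g \<in> carrier G" for g
  proof -
    note rg = r(2)[OF g]
    have "\<rho> g = \<rho> g * (B * L + S * Q)" unfolding SQ I using rg by simp
    also have "\<dots> = \<rho> g * (B * L) + \<rho> g * (S * Q)"
      using rg P S Q by (intro mult_add_distrib_mat) auto
    also have "\<rho> g * (B * L) = (\<rho> g * B) * L" using rg B L by (rule assoc_mult_mat[symmetric])
    also have "\<rho> g * (S * Q) = (\<rho> g * S) * Q" using rg S Q by (rule assoc_mult_mat[symmetric])
    finally have "mat_trace (\<rho> g) = mat_trace ((\<rho> g * B) * L + (\<rho> g * S) * Q)" by simp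
    also have "\<dots> = mat_trace ((\<rho> g * B) * L) + mat_trace ((\<rho> g * S) * Q)"
      using rg B L S Q by (intro mat_trace_add[of _ d]) auto
    also have "mat_trace ((\<rho> g * B) * L) = mat_trace (\<rho>1 g)"
      unfolding \<rho>1_def using rg B L by (intro mat_trace_mult_comm[of _ d k]) auto
    also have "mat_trace ((\<rho> g * S) * Q) = mat_trace (\<rho>2 g)"
      unfolding \<rho>2_def using rg S Q by (intro mat_trace_mult_comm[of _ d k']) auto
    finally show ?thesis .
  qed
  \<comment> \<open>The trace at \<open>\<one>\<close> is the dimension. Both blocks are therefore
    smaller than \<open>d\<close> as soon as neither is empty, and an empty block would make
    \<open>W\<close> zero or the whole space.\<close>
  have "of_nat d = (of_nat k + of_nat k' :: complex)"
    using tr[OF one_closed] unfolding r(1) is_repD(1)[OF rep1] is_repD(1)[OF rep2] mat_trace_one .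
  then have dk: "d = k + k'" unfolding of_nat_add[symmetric] of_nat_eq_iff .
  have zero_dim: "C *\<^sub>v v = 0\<^sub>v d" if "C \<in> carrier_mat d 0" "v \<in> carrier_vec 0" for C :: "complex mat" and v
    using that by (intro eq_vecI) (auto simp: scalar_prod_def)
  have "k \<noteq> 0"
  proof
    assume k0: "k = 0"
    have "w = 0\<^sub>v d" if w: "w \<in> W" for w
    proof -
      have "L *\<^sub>v w \<in> carrier_vec 0" using L w Wc k0 by auto
      then have "B *\<^sub>v (L *\<^sub>v w) = 0\<^sub>v d" using B k0 by (intro zero_dim) auto
      then show ?thesis using BL[OF w] by simp
    qed
    then show False using W0 W0' by blast
  qed
  moreover have "k' \<noteq> 0"
  proof
    assume k0: "k' = 0"
    have "v \<in> W" if v: "v \<in> carrier_vec d" for v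
    proof -
      have "M *\<^sub>v v = S *\<^sub>v (Q *\<^sub>v v)" using assoc_mult_mat_vec[OF S Q v] SQ by simp
      also have "\<dots> = 0\<^sub>v d" using S Q v k0 by (intro zero_dim) auto
      finally have Mv: "M *\<^sub>v v = 0\<^sub>v d" .
      have "v = (B * L + M) *\<^sub>v v" unfolding I using v by simp
      also have "\<dots> = (B * L) *\<^sub>v v + M *\<^sub>v v" using P M v by (rule add_mult_distrib_mat_vec)
      also have "(B * L) *\<^sub>v v = B *\<^sub>v (L *\<^sub>v v)" using B L v by (rule assoc_mult_mat_vec)
      finally have "v = B *\<^sub>v (L *\<^sub>v v) + 0\<^sub>v d" unfolding Mv .
      moreover have "B *\<^sub>v (L *\<^sub>v v) \<in> W" using L v by (intro BW) auto
      ultimately show ?thesis using Wc by auto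
    qed
    then show False using W1 Wc by blast
  qed
  ultimately show thesis using that[OF _ _ rep1 rep2 tr] dk by simp
qed

text \<open>Strong induction on the dimension, splitting at an invariant subspace. A list is used
  because irreducible characters may occur with multiplicity; dimension 0, which is not irreducible,
  gets the empty list.\<close>

lemma rep_character_decomposition:
  assumes "is_rep G d \<rho>"
  shows "\<exists>cs. set cs \<subseteq> Irr G \<and> (\<forall>g \<in> carrier G. mat_trace (\<rho> g) = (\<Sum>\<chi>\<leftarrow>cs. \<chi> g))"
  using assms
proof (induction d arbitrary: \<rho> rule: less_induct)
  case (less d)
  show ?case
  proof (cases "d = 0")
    case True
    then have "mat_trace (\<rho> g) = (\<Sum>\<chi>\<leftarrow>[]. \<chi> g)" if "g \<in> carrier G" for g
      using is_repD(2)[OF less.prems that] by (simp add: mat_trace_def)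
    then show ?thesis by (intro exI[of _ "[]"]) simp
  next
    case d: False
    show ?thesis
    proof (cases "irreducible_rep G d \<rho>")
      case True
      then have "rep_character G \<rho> \<in> Irr G" by (auto simp: Irr_def)
      then show ?thesis by (intro exI[of _ "[rep_character G \<rho>]"]) (simp add: rep_character_def)
    next
      case False
      then obtain W where "VectorSpace.subspace class_ring W (module_vec TYPE(complex) d)"
        "\<And>g w. g \<in> carrier G \<Longrightarrow> w \<in> W \<Longrightarrow> \<rho> g *\<^sub>v w \<in> W" "W \<noteq> {0\<^sub>v d}" "W \<noteq> carrier_vec d"
        using less.prems d unfolding irreducible_rep_def by blast
      then obtain k k' \<rho>1 \<rho>2 where
        k: "k < d" "k' < d" "is_rep G k \<rho>1" "is_rep G k' \<rho>2" and
        tr: "\<And>g. g \<in> carrier G \<Longrightarrow> mat_trace (\<rho> g) = mat_trace (\<rho>1 g) + mat_trace (\<rho>2 g)"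
        using character_splits_at_subspace[OF less.prems] by blast
      from less.IH[OF k(1,3)] less.IH[OF k(2,4)] obtain cs1 cs2 where
        "set cs1 \<subseteq> Irr G" "\<forall>g \<in> carrier G. mat_trace (\<rho>1 g) = (\<Sum>\<chi>\<leftarrow>cs1. \<chi> g)"
        "set cs2 \<subseteq> Irr G" "\<forall>g \<in> carrier G. mat_trace (\<rho>2 g) = (\<Sum>\<chi>\<leftarrow>cs2. \<chi> g)" by blast
      then show ?thesis using tr by (intro exI[of _ "cs1 @ cs2"]) auto
    qed
  qed
qed

section \<open>Irreducible characters as class functions\<close>

lemma IrrE:
  assumes "\<chi> \<in> Irr G"
  obtains d \<rho> where "irreducible_rep G d \<rho>" "\<chi> = rep_character G \<rho>"
    "\<And>g. g \<in> carrier G \<Longrightarrow> \<chi> g = mat_trace (\<rho> g)" "\<chi> \<one> = of_nat d" "0 < d"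
proof -
  from assms obtain d \<rho> where r: "irreducible_rep G d \<rho>" "\<chi> = rep_character G \<rho>"
    by (auto simp: Irr_def)
  moreover have "\<chi> g = mat_trace (\<rho> g)" if "g \<in> carrier G" for g
    using r that by (simp add: rep_character_def)
  moreover have "\<chi> \<one> = of_nat d"
    using r is_repD(1)[OF irreducible_repD(1)[OF r(1)]] by (simp add: rep_character_def mat_trace_one)
  ultimately show thesis using that irreducible_repD(2)[OF r(1)] by blast
qed

lemma Irr_one_neq_zero: "\<chi> \<in> Irr G \<Longrightarrow> \<chi> \<one> \<noteq> 0"
  by (auto elim!: IrrE)

lemma Irr_class_function:
  assumes \<chi>: "\<chi> \<in> Irr G" and g: "g \<in> carrier G" and t: "t \<in> carrier G"
  shows "\<chi> (t \<otimes> g \<otimes> inv t) = \<chi> g"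
proof -
  obtain d \<rho> where r: "irreducible_rep G d \<rho>" and c: "\<And>g. g \<in> carrier G \<Longrightarrow> \<chi> g = mat_trace (\<rho> g)"
    by (rule IrrE[OF \<chi>]) (rule that)
  note s = is_repD[OF irreducible_repD(1)[OF r]]
  have "\<chi> (t \<otimes> g \<otimes> inv t) = mat_trace (\<rho> (t \<otimes> g) * \<rho> (inv t))"
    using g t by (simp add: c s(3))
  also have "\<dots> = mat_trace (\<rho> (inv t) * \<rho> (t \<otimes> g))"
    using g t by (intro mat_trace_mult_comm[of _ d d] s) auto
  also have "\<rho> (inv t) * \<rho> (t \<otimes> g) = \<rho> (inv t \<otimes> (t \<otimes> g))" using g t by (simp add: s(3))
  also have "inv t \<otimes> (t \<otimes> g) = g" using g t by (simp add: m_assoc[symmetric])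
  finally show ?thesis using c g by simp
qed

lemma bij_betw_mult_left:
  "h \<in> carrier G \<Longrightarrow> bij_betw (\<lambda>g. h \<otimes> g) (carrier G) (carrier G)"
  by (rule bij_betw_byWitness[where f' = "\<lambda>g. inv h \<otimes> g"]) (auto simp: m_assoc[symmetric])

lemma bij_betw_conjugation:
  assumes t: "t \<in> carrier G"
  shows "bij_betw (\<lambda>g. t \<otimes> g \<otimes> inv t) (carrier G) (carrier G)"
proof (rule bij_betw_byWitness[where f' = "\<lambda>g. inv t \<otimes> g \<otimes> t"])
  show "\<forall>a\<in>carrier G. inv t \<otimes> (t \<otimes> a \<otimes> inv t) \<otimes> t = a"
    using t by (metis inv_closed inv_solve_left inv_solve_right m_assoc m_closed)
  show "\<forall>a\<in>carrier G. t \<otimes> (inv t \<otimes> a \<otimes> t) \<otimes> inv t = a"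
    using t by (metis inv_closed inv_solve_left inv_solve_right m_assoc m_closed)
qed (use t in auto)

end

section \<open>Characters of finite groups\<close>

locale finite_group = group +
  assumes finite_carrier: "finite (carrier G)"
begin

text \<open>Multiplying by \<open>\<sigma> h\<close> only shifts the summation index from g to h g.
  This turns an arbitrary matrix \<open>A\<close> into an intertwiner to which Schur's lemma
  applies.\<close>

lemma intertwiner_average:
  assumes \<rho>: "is_rep G d \<rho>" and \<sigma>: "is_rep G e \<sigma>" and A: "A \<in> carrier_mat e d"
    and h: "h \<in> carrier G"
  shows "\<sigma> h * mat_sum e d (\<lambda>g. \<sigma> g * A * \<rho> (inv g)) (carrier G) =
    mat_sum e d (\<lambda>g. \<sigma> g * A * \<rho> (inv g)) (carrier G) * \<rho> h"
proof -
  note r = is_repD[OF \<rho>] and s = is_repD[OF \<sigma>]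
  let ?F = "\<lambda>g. \<sigma> g * A * \<rho> (inv g)"
  have F: "?F g \<in> carrier_mat e d" if "g \<in> carrier G" for g
    using that A r(2) s(2) by (metis inv_closed mult_carrier_mat)
  have "mat_sum e d ?F (carrier G) * \<rho> h = mat_sum e d (\<lambda>g. ?F g * \<rho> h) (carrier G)"
    using r(2)[OF h] F by (rule mat_sum_mult)
  also have "\<dots> = mat_sum e d (\<lambda>g. ?F (h \<otimes> g) * \<rho> h) (carrier G)"
    by (rule mat_sum_reindex[OF bij_betw_mult_left[OF h]])
  also have "\<dots> = mat_sum e d (\<lambda>g. \<sigma> h * ?F g) (carrier G)"
  proof (rule mat_sum_cong)
    fix g assume g: "g \<in> carrier G"
    note c = s(2)[OF h] s(2)[OF g] r(2)[OF h] r(2)[OF inv_closed[OF g]]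
      r(2)[OF inv_closed[OF m_closed[OF h g]]]
    have "?F (h \<otimes> g) * \<rho> h = (\<sigma> (h \<otimes> g) * A) * (\<rho> (inv (h \<otimes> g)) * \<rho> h)"
      using A c s(3)[OF h g] by (intro assoc_mult_mat[of _ e d _ d _ d]) auto
    also have "\<rho> (inv (h \<otimes> g)) * \<rho> h = \<rho> (inv (h \<otimes> g) \<otimes> h)" using h g by (simp add: r(3))
    also have "inv (h \<otimes> g) \<otimes> h = inv g" using h g by (simp add: inv_mult_group m_assoc)
    also have "\<sigma> (h \<otimes> g) * A * \<rho> (inv g) = \<sigma> h * (\<sigma> g * A) * \<rho> (inv g)"
      unfolding s(3)[OF h g] using assoc_mult_mat[OF c(1,2) A] by simp
    also have "\<sigma> h * (\<sigma> g * A) * \<rho> (inv g) = \<sigma> h * ?F g"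
      using A c by (intro assoc_mult_mat[of _ e e _ d _ d]) auto
    finally show "?F (h \<otimes> g) * \<rho> h = \<sigma> h * ?F g" .
  qed
  also have "\<dots> = \<sigma> h * mat_sum e d ?F (carrier G)"
    using s(2)[OF h] F by (rule mult_mat_sum[symmetric])
  finally show ?thesis by simp
qed

text \<open>The matrix unit isolates one product of diagonal entries; summed over all i and j these
  products give the product of the two traces.\<close>

lemma mult_unit_mat_index:
  fixes A C :: "'c :: comm_semiring_1 mat"
  assumes A: "A \<in> carrier_mat e e" and C: "C \<in> carrier_mat d d" and i: "i < e" and j: "j < d"
  shows "(A * mat e d (\<lambda>p. if p = (i,j) then 1 else 0) * C) $$ (i,j) = A $$ (i,i) * C $$ (j,j)"
proof -
  let ?E = "mat e d (\<lambda>p. if p = (i,j) then 1 else 0) :: 'c mat"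
  have AE: "(A * ?E) $$ (i,l) = (if l = j then A $$ (i,i) else 0)" if l: "l < d" for l
  proof -
    have "(A * ?E) $$ (i,l) = (\<Sum>m=0..<e. A $$ (i,m) * (if m = i \<and> l = j then 1 else 0))"
      using A i l by (auto simp: scalar_prod_def)
    also have "\<dots> = (\<Sum>m=0..<e. if m = i then (if l = j then A $$ (i,m) else 0) else 0)"
      by (intro sum.cong) auto
    finally show ?thesis using i by simp
  qed
  have "(A * ?E * C) $$ (i,j) = (\<Sum>l=0..<d. (A * ?E) $$ (i,l) * C $$ (l,j))"
    using A C i j by (subst times_mat_def) (auto simp: scalar_prod_def)
  also have "\<dots> = (\<Sum>l=0..<d. if l = j then A $$ (i,i) * C $$ (l,j) else 0)"
    by (intro sum.cong) (simp_all add: AE)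
  finally show ?thesis using j by simp
qed

text \<open>Expresses the pairing of two characters through entries of averaged matrix units, which
  are intertwiners. Schur's lemma then evaluates each entry.\<close>

lemma sum_trace_mult_trace_inv:
  fixes \<rho> \<sigma> :: "'a \<Rightarrow> complex mat"
  assumes \<rho>: "is_rep G d \<rho>" and \<sigma>: "is_rep G e \<sigma>"
  shows "(\<Sum>g\<in>carrier G. mat_trace (\<sigma> g) * mat_trace (\<rho> (inv g))) =
    (\<Sum>i<e. \<Sum>j<d. mat_sum e d (\<lambda>g. \<sigma> g * mat e d (\<lambda>p. if p = (i,j) then 1 else 0) * \<rho> (inv g))
       (carrier G) $$ (i,j))"
proof -
  note r = is_repD[OF \<rho>] and s = is_repD[OF \<sigma>]
  have "(\<Sum>i<e. \<Sum>j<d. mat_sum e d (\<lambda>g. \<sigma> g * mat e d (\<lambda>p. if p = (i,j) then 1 else 0) * \<rho> (inv g))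
       (carrier G) $$ (i,j)) = (\<Sum>i<e. \<Sum>j<d. \<Sum>g\<in>carrier G. \<sigma> g $$ (i,i) * \<rho> (inv g) $$ (j,j))"
  proof (intro sum.cong refl)
    fix i j assume "i \<in> {..<e}" "j \<in> {..<d}"
    then have ij: "i < e" "j < d" by auto
    show "mat_sum e d (\<lambda>g. \<sigma> g * mat e d (\<lambda>p. if p = (i,j) then 1 else 0) * \<rho> (inv g))
       (carrier G) $$ (i,j) = (\<Sum>g\<in>carrier G. \<sigma> g $$ (i,i) * \<rho> (inv g) $$ (j,j))"
      unfolding mat_sum_index[OF ij]
      by (intro sum.cong refl mult_unit_mat_index s(2) r(2) inv_closed ij)
  qed
  also have "\<dots> = (\<Sum>i<e. \<Sum>g\<in>carrier G. \<Sum>j<d. \<sigma> g $$ (i,i) * \<rho> (inv g) $$ (j,j))"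
    by (intro sum.cong refl sum.swap)
  also have "\<dots> = (\<Sum>g\<in>carrier G. \<Sum>i<e. \<Sum>j<d. \<sigma> g $$ (i,i) * \<rho> (inv g) $$ (j,j))"
    by (rule sum.swap)
  also have "\<dots> = (\<Sum>g\<in>carrier G. mat_trace (\<sigma> g) * mat_trace (\<rho> (inv g)))"
  proof (intro sum.cong refl)
    fix g assume g: "g \<in> carrier G"
    show "(\<Sum>i<e. \<Sum>j<d. \<sigma> g $$ (i,i) * \<rho> (inv g) $$ (j,j)) = mat_trace (\<sigma> g) * mat_trace (\<rho> (inv g))"
      using s(2)[OF g] r(2)[OF inv_closed[OF g]] by (simp add: mat_trace_def sum_product)
  qed
  finally show ?thesis by simp
qed

text \<open>Averaging the matrix unit E_ij gives a scalar matrix. Conjugation preserves traces, so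
  its trace is |G| if i = j and 0 otherwise. Thus each of the d diagonal pairs contributes |G| / d,
  and the other pairs contribute nothing.\<close>

lemma character_norm:
  assumes \<rho>: "irreducible_rep G d \<rho>"
  shows "(\<Sum>g\<in>carrier G. mat_trace (\<rho> g) * mat_trace (\<rho> (inv g))) = of_nat (card (carrier G))"
proof -
  note r = is_repD[OF irreducible_repD(1)[OF \<rho>]]
  have d: "0 < d" by (rule irreducible_repD(2)[OF \<rho>])
  let ?N = "of_nat (card (carrier G)) :: complex"
  have "mat_sum d d (\<lambda>g. \<rho> g * mat d d (\<lambda>p. if p = (i,j) then 1 else 0) * \<rho> (inv g)) (carrier G) $$ (i,j)
    = (if i = j then ?N / of_nat d else 0)" (is "?T $$ _ = _") if ij: "i < d" "j < d" for i j
  proof -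
    let ?E = "mat d d (\<lambda>p. if p = (i,j) then 1 else 0) :: complex mat"
    have E: "?E \<in> carrier_mat d d" by simp
    have F: "\<rho> g * ?E * \<rho> (inv g) \<in> carrier_mat d d" if "g \<in> carrier G" for g
      using r(2)[OF that] r(2)[OF inv_closed[OF that]] by auto
    have trE: "mat_trace ?E = (if i = j then 1 else 0)"
    proof -
      have "mat_trace ?E = (\<Sum>l<d. if l = i then (if i = j then 1 else 0) else 0)"
        by (auto simp: mat_trace_def intro!: sum.cong)
      then show ?thesis using ij by simp
    qed
    have "mat_trace ?T = (\<Sum>g\<in>carrier G. mat_trace (\<rho> g * ?E * \<rho> (inv g)))"
      by (rule mat_trace_mat_sum) (rule F)
    also have "\<dots> = (\<Sum>g\<in>carrier G. mat_trace ?E)"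
    proof (intro sum.cong refl)
      fix g assume g: "g \<in> carrier G"
      note rg = r(2)[OF g] and ri = r(2)[OF inv_closed[OF g]]
      have "mat_trace (\<rho> g * ?E * \<rho> (inv g)) = mat_trace (\<rho> (inv g) * (\<rho> g * ?E))"
        using rg ri by (intro mat_trace_mult_comm[of _ d d]) auto
      also have "\<rho> (inv g) * (\<rho> g * ?E) = (\<rho> (inv g) * \<rho> g) * ?E"
        using ri rg E by (rule assoc_mult_mat[symmetric])
      also have "\<rho> (inv g) * \<rho> g = 1\<^sub>m d" using r(3)[of "inv g" g] r(1) g by simp
      finally show "mat_trace (\<rho> g * ?E * \<rho> (inv g)) = mat_trace ?E" using E by simp
    qed
    finally have tr: "mat_trace ?T = ?N * (if i = j then 1 else 0)" by (simp add: trE)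
    have "?T = (mat_trace ?T / of_nat d) \<cdot>\<^sub>m 1\<^sub>m d"
      by (rule schur_scalar[OF \<rho> mat_sum_carrier])
        (rule intertwiner_average[OF irreducible_repD(1)[OF \<rho>] irreducible_repD(1)[OF \<rho>] E])
    then have "?T $$ (i,j) = ((mat_trace ?T / of_nat d) \<cdot>\<^sub>m 1\<^sub>m d) $$ (i,j)" by (rule arg_cong)
    also have "\<dots> = (mat_trace ?T / of_nat d) * (if i = j then 1 else 0)" using ij by simp
    finally show ?thesis unfolding tr by (auto split: if_splits)
  qed
  then have "(\<Sum>g\<in>carrier G. mat_trace (\<rho> g) * mat_trace (\<rho> (inv g))) =
      (\<Sum>i<d. \<Sum>j<d. if i = j then ?N / of_nat d else 0)"
    unfolding sum_trace_mult_trace_inv[OF irreducible_repD(1)[OF \<rho>] irreducible_repD(1)[OF \<rho>]]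
    by (intro sum.cong refl) simp
  also have "\<dots> = ?N" using d by simp
  finally show ?thesis .
qed

text \<open>A nonzero average would be an intertwiner and force equal traces, by
  \<open>intertwiner_trace_eq\<close>; hence all averages vanish when the characters differ.\<close>

lemma character_orthogonal:
  assumes \<rho>: "irreducible_rep G d \<rho>" and \<sigma>: "irreducible_rep G e \<sigma>"
    and ne: "rep_character G \<rho> \<noteq> rep_character G \<sigma>"
  shows "(\<Sum>g\<in>carrier G. mat_trace (\<sigma> g) * mat_trace (\<rho> (inv g))) = 0"
proof -
  obtain h where h: "h \<in> carrier G" "mat_trace (\<rho> h) \<noteq> mat_trace (\<sigma> h)"
    using ne by (auto simp: rep_character_def restrict_def fun_eq_iff split: if_splits)
  have "mat_sum e d (\<lambda>g. \<sigma> g * A * \<rho> (inv g)) (carrier G) = 0\<^sub>m e d"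
    if A: "A \<in> carrier_mat e d" for A
  proof (rule ccontr)
    assume "mat_sum e d (\<lambda>g. \<sigma> g * A * \<rho> (inv g)) (carrier G) \<noteq> 0\<^sub>m e d"
    then have "mat_trace (\<rho> h) = mat_trace (\<sigma> h)"
      by (intro intertwiner_trace_eq[OF \<rho> \<sigma> mat_sum_carrier _ _ h(1)])
        (rule intertwiner_average[OF irreducible_repD(1)[OF \<rho>] irreducible_repD(1)[OF \<sigma>] A])
    then show False using h(2) by simp
  qed
  then have "mat_sum e d (\<lambda>g. \<sigma> g * mat e d (\<lambda>p. if p = (i,j) then 1 else 0) * \<rho> (inv g)) (carrier G)
      = 0\<^sub>m e d" for i j by simp
  then show ?thesis
    unfolding sum_trace_mult_trace_inv[OF irreducible_repD(1)[OF \<rho>] irreducible_repD(1)[OF \<sigma>]]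
    by (intro sum.neutral ballI) simp
qed

lemma Irr_orthogonality:
  assumes \<chi>: "\<chi> \<in> Irr G" and \<psi>: "\<psi> \<in> Irr G"
  shows "(\<Sum>g\<in>carrier G. \<chi> g * \<psi> (inv g)) = (if \<chi> = \<psi> then of_nat (card (carrier G)) else 0)"
proof -
  obtain e \<sigma> where s: "irreducible_rep G e \<sigma>" "\<chi> = rep_character G \<sigma>"
    "\<And>g. g \<in> carrier G \<Longrightarrow> \<chi> g = mat_trace (\<sigma> g)" by (rule IrrE[OF \<chi>]) (rule that)
  obtain d \<rho> where r: "irreducible_rep G d \<rho>" "\<psi> = rep_character G \<rho>"
    "\<And>g. g \<in> carrier G \<Longrightarrow> \<psi> g = mat_trace (\<rho> g)" by (rule IrrE[OF \<psi>]) (rule that)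
  show ?thesis
  proof (cases "\<chi> = \<psi>")
    \<comment> \<open>Equal characters may be computed from the same representation
      \<open>\<rho>\<close>, so no isomorphism between \<open>\<rho>\<close> and
      \<open>\<sigma>\<close> has to be produced.\<close>
    case True
    have "(\<Sum>g\<in>carrier G. \<chi> g * \<psi> (inv g)) = (\<Sum>g\<in>carrier G. mat_trace (\<rho> g) * mat_trace (\<rho> (inv g)))"
      unfolding True by (intro sum.cong refl) (simp add: r(3))
    then show ?thesis using True character_norm[OF r(1)] by simp
  next
    case False
    have "(\<Sum>g\<in>carrier G. \<chi> g * \<psi> (inv g)) = (\<Sum>g\<in>carrier G. mat_trace (\<sigma> g) * mat_trace (\<rho> (inv g)))"
      by (intro sum.cong refl) (simp add: r(3) s(3))
    then show ?thesis using False character_orthogonal[OF r(1) s(1)] r(2) s(2) by simp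
  qed
qed

text \<open>Left multiplication written as permutation matrices, with \<open>f\<close> numbering the
  group elements. The trace counts fixed points of g, and there are none unless g is the
  identity.\<close>

lemma regular_rep_exists:
  obtains R where "is_rep G (card (carrier G)) R"
    "\<And>g. g \<in> carrier G \<Longrightarrow> mat_trace (R g) = (if g = \<one> then of_nat (card (carrier G)) else 0)"
proof -
  let ?N = "card (carrier G)"
  obtain f where f: "bij_betw f {0..<?N} (carrier G)"
    using ex_bij_betw_nat_finite[OF finite_carrier] by blast
  have fc: "f i \<in> carrier G" if "i < ?N" for i using f that by (auto simp: bij_betw_def)
  have finj: "f i = f j \<longleftrightarrow> i = j" if "i < ?N" "j < ?N" for i j
    using f that by (auto simp: bij_betw_def inj_on_def)
  define R where "R g = (mat ?N ?N (\<lambda>(i,j). if f i = g \<otimes> f j then 1 else 0) :: complex mat)" for g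
  have "is_rep G ?N R"
    unfolding is_rep_iff
  proof (intro conjI ballI)
    show "R \<one> = 1\<^sub>m ?N" by (rule eq_matI) (auto simp: R_def fc finj)
    fix g assume g: "g \<in> carrier G"
    show "R g \<in> carrier_mat ?N ?N" by (simp add: R_def)
    fix h assume h: "h \<in> carrier G"
    show "R (g \<otimes> h) = R g * R h"
    proof (rule eq_matI)
      fix i j assume "i < dim_row (R g * R h)" "j < dim_col (R g * R h)"
      then have ij: "i < ?N" "j < ?N" by (auto simp: R_def)
      have "h \<otimes> f j \<in> f ` {0..<?N}" using f h fc[OF ij(2)] by (simp add: bij_betw_def)
      then obtain m where m: "m < ?N" "f m = h \<otimes> f j" by auto
      have "(R g * R h) $$ (i,j) =
          (\<Sum>l=0..<?N. (if f i = g \<otimes> f l then 1 else 0) * (if f l = h \<otimes> f j then 1 else 0))"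
        using ij by (auto simp: R_def scalar_prod_def intro!: sum.cong)
      also have "\<dots> = (\<Sum>l=0..<?N. if l = m then (if f i = g \<otimes> f m then 1 else 0) else 0)"
        by (intro sum.cong) (auto simp: m(2)[symmetric] finj m(1))
      also have "\<dots> = (if f i = g \<otimes> f m then 1 else 0)" using m by simp
      also have "\<dots> = R (g \<otimes> h) $$ (i,j)"
        using ij m g h fc by (simp add: R_def m_assoc)
      finally show "R (g \<otimes> h) $$ (i,j) = (R g * R h) $$ (i,j)" by simp
    qed (auto simp: R_def)
  qed
  moreover have "mat_trace (R g) = (if g = \<one> then of_nat ?N else 0)" if g: "g \<in> carrier G" for g
  proof -
    have "f i = g \<otimes> f i \<longleftrightarrow> g = \<one>" if "i < ?N" for i
      using g fc[OF that] r_cancel_one' by blast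
    then have "mat_trace (R g) = (\<Sum>i<?N. if g = \<one> then 1 else 0)"
      by (auto simp: mat_trace_def R_def intro!: sum.cong)
    then show ?thesis by simp
  qed
  ultimately show thesis using that by blast
qed

text \<open>Pairing the regular character with \<chi> gives |G| \<chi>(1), since it is supported at
  the identity; by orthogonality the same pairing is |G| times the multiplicity of \<chi> in the
  decomposition. So that multiplicity is the degree.\<close>

lemma sum_degree_character:
  assumes g: "g \<in> carrier G"
  shows "(\<Sum>\<chi>\<in>Irr G. \<chi> \<one> * \<chi> g) = (if g = \<one> then of_nat (card (carrier G)) else 0)"
proof -
  let ?N = "of_nat (card (carrier G)) :: complex"
  obtain R where R: "is_rep G (card (carrier G)) R"
    "\<And>g. g \<in> carrier G \<Longrightarrow> mat_trace (R g) = (if g = \<one> then ?N else 0)"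
    by (rule regular_rep_exists) (rule that)
  obtain cs where cs: "set cs \<subseteq> Irr G" and tr: "\<And>g. g \<in> carrier G \<Longrightarrow> mat_trace (R g) = (\<Sum>\<chi>\<leftarrow>cs. \<chi> g)"
    using rep_character_decomposition[OF R(1)] by blast
  have N0: "?N \<noteq> 0" using finite_carrier by auto
  have listsum: "(\<Sum>\<chi>\<leftarrow>ds. F \<chi>) = (\<Sum>\<chi>\<in>set ds. of_nat (count_list ds \<chi>) * F \<chi>)"
    for ds and F :: "('a \<Rightarrow> complex) \<Rightarrow> complex"
  proof (induction ds)
    case (Cons c ds)
    have "(\<Sum>\<chi>\<in>set (c # ds). of_nat (count_list (c # ds) \<chi>) * F \<chi>) =
        (\<Sum>\<chi>\<in>insert c (set ds). (if \<chi> = c then F c else 0) + of_nat (count_list ds \<chi>) * F \<chi>)"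
      by (intro sum.cong) (auto simp: algebra_simps)
    also have "\<dots> = F c + (\<Sum>\<chi>\<in>insert c (set ds). of_nat (count_list ds \<chi>) * F \<chi>)"
      by (simp add: sum.distrib)
    also have "(\<Sum>\<chi>\<in>insert c (set ds). of_nat (count_list ds \<chi>) * F \<chi>) =
        (\<Sum>\<chi>\<in>set ds. of_nat (count_list ds \<chi>) * F \<chi>)"
      by (intro sum.mono_neutral_right) (auto simp: count_list_0_iff)
    finally show ?case using Cons by simp
  qed simp
  have mult: "of_nat (count_list cs \<chi>) = \<chi> \<one>" if \<chi>: "\<chi> \<in> Irr G" for \<chi>
  proof -
    have "?N * \<chi> \<one> = (\<Sum>g\<in>carrier G. if g = \<one> then ?N * \<chi> (inv g) else 0)"
      using finite_carrier by simp
    also have "\<dots> = (\<Sum>g\<in>carrier G. (\<Sum>\<psi>\<in>set cs. of_nat (count_list cs \<psi>) * \<psi> g) * \<chi> (inv g))"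
      using R(2) tr by (intro sum.cong refl) (auto simp: listsum[symmetric])
    also have "\<dots> = (\<Sum>\<psi>\<in>set cs. of_nat (count_list cs \<psi>) * (\<Sum>g\<in>carrier G. \<psi> g * \<chi> (inv g)))"
      by (simp add: sum_distrib_left sum_distrib_right mult.assoc sum.swap[of _ "set cs"])
    also have "\<dots> = (\<Sum>\<psi>\<in>set cs. if \<psi> = \<chi> then of_nat (count_list cs \<chi>) * ?N else 0)"
      using cs \<chi> by (intro sum.cong refl) (auto simp: Irr_orthogonality subset_iff)
    also have "\<dots> = of_nat (count_list cs \<chi>) * ?N"
      by (simp add: count_list_0_iff)
    finally show ?thesis using N0 by simp
  qed
  \<comment> \<open>Degrees are positive, so every irreducible character occurs in the finite list
    \<open>cs\<close>. This is where \<open>Irr G\<close> becomes finite.\<close>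
  have "Irr G \<subseteq> set cs"
  proof
    fix \<chi> assume \<chi>: "\<chi> \<in> Irr G"
    obtain d where "\<chi> \<one> = of_nat d" "0 < d" by (rule IrrE[OF \<chi>]) (rule that)
    then have "count_list cs \<chi> \<noteq> 0" using mult[OF \<chi>] by auto
    then show "\<chi> \<in> set cs" by (simp add: count_list_0_iff)
  qed
  with cs have eq: "Irr G = set cs" by simp
  have "(\<Sum>\<chi>\<in>Irr G. \<chi> \<one> * \<chi> g) = (\<Sum>\<chi>\<in>set cs. of_nat (count_list cs \<chi>) * \<chi> g)"
    using mult by (intro sum.cong) (auto simp: eq)
  also have "\<dots> = mat_trace (R g)" using tr[OF g] by (simp add: listsum)
  finally show ?thesis using R(2)[OF g] by simp
qed

text \<open>By Lagrange \<open>\<rho> g\<close> has finite order dividing |G|, and the inverse of g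
  is its power with exponent |G| - 1, the situation of
  \<open>mat_trace_finite_order\<close>.\<close>

lemma character_inv:
  assumes \<chi>: "\<chi> \<in> Irr G" and g: "g \<in> carrier G"
  shows "\<chi> (inv g) = cnj (\<chi> g)"
proof -
  obtain d \<rho> where r: "irreducible_rep G d \<rho>" "\<And>g. g \<in> carrier G \<Longrightarrow> \<chi> g = mat_trace (\<rho> g)"
    by (rule IrrE[OF \<chi>]) (rule that)
  note s = is_repD[OF irreducible_repD(1)[OF r(1)]]
  have pow: "\<rho> (g [^] k) = \<rho> g ^\<^sub>m k" for k :: nat
    by (induction k) (use s g in auto)
  let ?m = "Coset.order G"
  have "?m > 0" using finite_carrier order_gt_0_iff_finite by blast
  then obtain k where k: "?m = Suc k" by (cases ?m) auto
  have "g [^] Suc k = \<one>" using pow_order_eq_1[OF g] k by simp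
  then have "\<rho> g ^\<^sub>m Suc k = 1\<^sub>m d" and "inv g = g [^] k"
    using pow[of "Suc k"] s(1) g by (auto simp: inv_equality)
  then show ?thesis
    using mat_trace_finite_order[OF s(2)[OF g], of k] pow[of k] r(2) g by simp
qed

text \<open>Conjugation by t permutes the summands and leaves the coefficients alone, so the matrix
  commutes with every \<open>\<rho> t\<close> and \<open>schur_scalar\<close> applies.\<close>

lemma class_function_scalar:
  assumes \<rho>: "irreducible_rep G d \<rho>"
    and f: "\<And>t g. t \<in> carrier G \<Longrightarrow> g \<in> carrier G \<Longrightarrow> f (t \<otimes> g \<otimes> inv t) = f g"
  shows "mat_sum d d (\<lambda>g. f g \<cdot>\<^sub>m \<rho> g) (carrier G) =
    ((\<Sum>g\<in>carrier G. f g * mat_trace (\<rho> g)) / of_nat d) \<cdot>\<^sub>m 1\<^sub>m d"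
proof -
  note r = is_repD[OF irreducible_repD(1)[OF \<rho>]]
  let ?T = "mat_sum d d (\<lambda>g. f g \<cdot>\<^sub>m \<rho> g) (carrier G)"
  have F: "f g \<cdot>\<^sub>m \<rho> g \<in> carrier_mat d d" if "g \<in> carrier G" for g using r(2)[OF that] by simp
  have "\<rho> t * ?T = ?T * \<rho> t" if t: "t \<in> carrier G" for t
  proof -
    have "?T * \<rho> t = mat_sum d d (\<lambda>g. f g \<cdot>\<^sub>m \<rho> g * \<rho> t) (carrier G)"
      by (rule mat_sum_mult[OF r(2)[OF t] F])
    also have "\<dots> = mat_sum d d (\<lambda>g. f (t \<otimes> g \<otimes> inv t) \<cdot>\<^sub>m \<rho> (t \<otimes> g \<otimes> inv t) * \<rho> t) (carrier G)"
      by (rule mat_sum_reindex[OF bij_betw_conjugation[OF t]])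
    also have "\<dots> = mat_sum d d (\<lambda>g. \<rho> t * (f g \<cdot>\<^sub>m \<rho> g)) (carrier G)"
    proof (rule mat_sum_cong)
      fix g assume g: "g \<in> carrier G"
      have "f (t \<otimes> g \<otimes> inv t) \<cdot>\<^sub>m \<rho> (t \<otimes> g \<otimes> inv t) * \<rho> t = f g \<cdot>\<^sub>m (\<rho> (t \<otimes> g \<otimes> inv t) * \<rho> t)"
        unfolding f[OF t g] using g t by (intro mult_smult_assoc_mat[OF r(2) r(2)]) auto
      also have "\<rho> (t \<otimes> g \<otimes> inv t) * \<rho> t = \<rho> (t \<otimes> g \<otimes> inv t \<otimes> t)" using g t by (intro r(3)[symmetric]) auto
      also have "t \<otimes> g \<otimes> inv t \<otimes> t = t \<otimes> g" using g t by (simp add: m_assoc)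
      also have "\<rho> (t \<otimes> g) = \<rho> t * \<rho> g" using t g by (rule r(3))
      also have "f g \<cdot>\<^sub>m (\<rho> t * \<rho> g) = \<rho> t * (f g \<cdot>\<^sub>m \<rho> g)"
        using g t by (intro mult_smult_distrib[OF r(2) r(2), symmetric]) auto
      finally show "f (t \<otimes> g \<otimes> inv t) \<cdot>\<^sub>m \<rho> (t \<otimes> g \<otimes> inv t) * \<rho> t = \<rho> t * (f g \<cdot>\<^sub>m \<rho> g)" .
    qed
    also have "\<dots> = \<rho> t * ?T" by (rule mult_mat_sum[OF r(2)[OF t] F, symmetric])
    finally show ?thesis by simp
  qed
  then have "?T = (mat_trace ?T / of_nat d) \<cdot>\<^sub>m 1\<^sub>m d" by (rule schur_scalar[OF \<rho> mat_sum_carrier])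
  also have "mat_trace ?T = (\<Sum>g\<in>carrier G. f g * mat_trace (\<rho> g))"
    using F r(2) by (simp add: mat_trace_mat_sum mat_trace_smult[OF r(2)] cong: sum.cong)
  finally show ?thesis .
qed

text \<open>Two evaluations of the trace of T \<rho>(k), where T is the matrix by which
  \<open>f\<close> acts: term by term, and with T replaced by its scalar. Moving the degree to the
  left avoids a division.\<close>

lemma sum_class_function_mult_character:
  assumes \<chi>: "\<chi> \<in> Irr G" and k: "k \<in> carrier G"
    and f: "\<And>t g. t \<in> carrier G \<Longrightarrow> g \<in> carrier G \<Longrightarrow> f (t \<otimes> g \<otimes> inv t) = f g"
  shows "\<chi> \<one> * (\<Sum>g\<in>carrier G. f g * \<chi> (g \<otimes> k)) = (\<Sum>g\<in>carrier G. f g * \<chi> g) * \<chi> k"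
proof -
  obtain d \<rho> where r: "irreducible_rep G d \<rho>" "\<And>g. g \<in> carrier G \<Longrightarrow> \<chi> g = mat_trace (\<rho> g)"
    and d: "\<chi> \<one> = of_nat d" "0 < d"
    by (rule IrrE[OF \<chi>]) (rule that)
  note s = is_repD[OF irreducible_repD(1)[OF r(1)]]
  let ?T = "mat_sum d d (\<lambda>g. f g \<cdot>\<^sub>m \<rho> g) (carrier G)"
  have F: "f g \<cdot>\<^sub>m \<rho> g \<in> carrier_mat d d" if "g \<in> carrier G" for g using s(2)[OF that] by simp
  have "mat_trace (?T * \<rho> k) = mat_trace (mat_sum d d (\<lambda>g. f g \<cdot>\<^sub>m \<rho> g * \<rho> k) (carrier G))"
    by (simp only: mat_sum_mult[OF s(2)[OF k] F])
  also have "\<dots> = (\<Sum>g\<in>carrier G. mat_trace (f g \<cdot>\<^sub>m \<rho> g * \<rho> k))"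
    by (intro mat_trace_mat_sum mult_carrier_mat[of _ d d] F s(2) k)
  also have "\<dots> = (\<Sum>g\<in>carrier G. f g * \<chi> (g \<otimes> k))"
  proof (intro sum.cong refl)
    fix g assume g: "g \<in> carrier G"
    have "f g \<cdot>\<^sub>m \<rho> g * \<rho> k = f g \<cdot>\<^sub>m \<rho> (g \<otimes> k)"
      unfolding s(3)[OF g k] using s(2)[OF g] s(2)[OF k] by (rule mult_smult_assoc_mat)
    then show "mat_trace (f g \<cdot>\<^sub>m \<rho> g * \<rho> k) = f g * \<chi> (g \<otimes> k)"
      using g k by (simp add: mat_trace_smult[OF s(2)] r(2))
  qed
  finally have *: "mat_trace (?T * \<rho> k) = (\<Sum>g\<in>carrier G. f g * \<chi> (g \<otimes> k))" .
  have "?T * \<rho> k = ((\<Sum>g\<in>carrier G. f g * mat_trace (\<rho> g)) / of_nat d) \<cdot>\<^sub>m (1\<^sub>m d * \<rho> k)"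
    unfolding class_function_scalar[where f = f, OF r(1) f, simplified] using s(2)[OF k] by (intro mult_smult_assoc_mat) auto
  then have "mat_trace (?T * \<rho> k) = ((\<Sum>g\<in>carrier G. f g * mat_trace (\<rho> g)) / of_nat d) * mat_trace (\<rho> k)"
    using s(2)[OF k] by (simp add: mat_trace_smult[OF s(2)[OF k]])
  then show ?thesis
    unfolding * using d r(2)[OF k] by (simp add: r(2) cong: sum.cong)
qed

text \<open>After \<open>sum_class_function_mult_character\<close> at \<open>inv k\<close>, the sum
  over \<open>Irr G\<close> is that of \<open>sum_degree_character\<close> at
  \<open>g \<otimes> inv k\<close>, which selects g = k.\<close>

lemma class_function_inversion:
  assumes f: "\<And>t g. t \<in> carrier G \<Longrightarrow> g \<in> carrier G \<Longrightarrow> f (t \<otimes> g \<otimes> inv t) = f g"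
    and k: "k \<in> carrier G"
  shows "of_nat (card (carrier G)) * f k =
    (\<Sum>\<chi>\<in>Irr G. (\<Sum>g\<in>carrier G. f g * \<chi> g) * \<chi> (inv k))"
proof -
  have "(\<Sum>\<chi>\<in>Irr G. (\<Sum>g\<in>carrier G. f g * \<chi> g) * \<chi> (inv k)) =
      (\<Sum>\<chi>\<in>Irr G. \<chi> \<one> * (\<Sum>g\<in>carrier G. f g * \<chi> (g \<otimes> inv k)))"
    using k by (intro sum.cong refl sum_class_function_mult_character[symmetric] f) auto
  also have "\<dots> = (\<Sum>g\<in>carrier G. f g * (\<Sum>\<chi>\<in>Irr G. \<chi> \<one> * \<chi> (g \<otimes> inv k)))"
    by (simp add: sum_distrib_left sum.swap[of _ "Irr G"] mult.left_commute)
  also have "\<dots> = (\<Sum>g\<in>carrier G. if g = k then f g * of_nat (card (carrier G)) else 0)"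
  proof (intro sum.cong refl)
    fix g assume g: "g \<in> carrier G"
    have "g \<otimes> inv k = \<one> \<longleftrightarrow> g = k"
      using g k by (metis inv_closed inv_equality inv_inv r_inv)
    then show "f g * (\<Sum>\<chi>\<in>Irr G. \<chi> \<one> * \<chi> (g \<otimes> inv k)) =
        (if g = k then f g * of_nat (card (carrier G)) else 0)"
      using sum_degree_character[of "g \<otimes> inv k"] g k by simp
  qed
  also have "\<dots> = of_nat (card (carrier G)) * f k" using k finite_carrier by simp
  finally show ?thesis by simp
qed

end

section \<open>Products of conjugacy classes\<close>

context group
begin

lemma conj_class_eq: "x \<in> carrier G \<Longrightarrow> conj_class G x = (\<lambda>t. t \<otimes> x \<otimes> inv t) ` carrier G"
  by (auto simp: conj_class_def orbit_def conj_action_def)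

lemma conj_class_subset: "x \<in> carrier G \<Longrightarrow> conj_class G x \<subseteq> carrier G"
  by (auto simp: conj_class_eq)

lemma conj_class_self: "x \<in> carrier G \<Longrightarrow> x \<in> conj_class G x"
  by (auto simp: conj_class_eq intro!: image_eqI[where x = \<one>])

lemma conjugation_mult:
  assumes "s \<in> carrier G" "t \<in> carrier G" "x \<in> carrier G"
  shows "s \<otimes> (t \<otimes> x \<otimes> inv t) \<otimes> inv s = (s \<otimes> t) \<otimes> x \<otimes> inv (s \<otimes> t)"
  using assms by (simp add: inv_mult_group m_assoc)

lemma conj_class_subset_if_mem:
  assumes x: "x \<in> carrier G" and y: "y \<in> conj_class G x"
  shows "conj_class G y \<subseteq> conj_class G x"
proof
  fix z assume z: "z \<in> conj_class G y"
  obtain t where t: "t \<in> carrier G" "y = t \<otimes> x \<otimes> inv t" using y x by (auto simp: conj_class_eq)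
  then have "y \<in> carrier G" using x by simp
  then obtain s where s: "s \<in> carrier G" "z = s \<otimes> y \<otimes> inv s" using z by (auto simp: conj_class_eq)
  have "z = (s \<otimes> t) \<otimes> x \<otimes> inv (s \<otimes> t)"
    unfolding s(2) t(2) using s t x by (intro conjugation_mult)
  then show "z \<in> conj_class G x" using s t x by (auto simp: conj_class_eq)
qed

lemma conj_class_sym:
  assumes x: "x \<in> carrier G" and y: "y \<in> conj_class G x"
  shows "x \<in> conj_class G y"
proof -
  obtain t where t: "t \<in> carrier G" "y = t \<otimes> x \<otimes> inv t" using y x by (auto simp: conj_class_eq)
  then have yc: "y \<in> carrier G" using x by simp
  have "inv t \<otimes> y \<otimes> inv (inv t) = (inv t \<otimes> t) \<otimes> x \<otimes> inv (inv t \<otimes> t)"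
    unfolding t(2) using t x by (intro conjugation_mult) auto
  then have "inv t \<otimes> y \<otimes> inv (inv t) = x" using t x by simp
  then show ?thesis
    using imageI[of "inv t" "carrier G" "\<lambda>s. s \<otimes> y \<otimes> inv s"] t(1) by (simp add: conj_class_eq[OF yc])
qed

lemma conj_class_eq_if_mem:
  assumes x: "x \<in> carrier G" and y: "y \<in> conj_class G x"
  shows "conj_class G y = conj_class G x"
proof -
  have "y \<in> carrier G" using conj_class_subset[OF x] y by blast
  then show ?thesis
    using conj_class_subset_if_mem conj_class_sym[OF x y] x y by blast
qed

text \<open>Makes the indicator of a class a class function, both in the recursion for the counts
  and in the comparison function of \<open>num_factorizations_eq_if_character_eq\<close>.\<close>

lemma conj_mem_conj_class_iff:
  assumes x: "x \<in> carrier G" and t: "t \<in> carrier G" and g: "g \<in> carrier G"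
  shows "t \<otimes> g \<otimes> inv t \<in> conj_class G x \<longleftrightarrow> g \<in> conj_class G x"
proof -
  let ?h = "t \<otimes> g \<otimes> inv t"
  have h: "?h \<in> conj_class G g" using g t by (auto simp: conj_class_eq)
  have "g \<in> conj_class G ?h" by (rule conj_class_sym[OF g h])
  then show ?thesis
    using h conj_class_subset_if_mem[OF x] by blast
qed

lemma set_inv_conj_class:
  assumes x: "x \<in> carrier G"
  shows "set_inv (conj_class G x) = conj_class G (inv x)"
proof -
  have "inv (t \<otimes> x \<otimes> inv t) = t \<otimes> inv x \<otimes> inv t" if "t \<in> carrier G" for t
    using that x by (simp add: inv_mult_group m_assoc)
  then show ?thesis using x by (auto simp: SET_INV_def conj_class_eq)
qed

lemma card_conj_class_inv:
  assumes x: "x \<in> carrier G"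
  shows "card (conj_class G (inv x)) = card (conj_class G x)"
proof -
  have "conj_class G (inv x) = (\<lambda>g. inv g) ` conj_class G x"
    unfolding set_inv_conj_class[OF x, symmetric] by (auto simp: SET_INV_def)
  moreover have "inj_on (\<lambda>g. inv g) (conj_class G x)"
    using inj_on_subset[OF inv_inj conj_class_subset[OF x]] .
  ultimately show ?thesis by (simp add: card_image)
qed

lemma conj_classesE:
  assumes "D \<in> conj_classes G"
  obtains y where "y \<in> carrier G" "D = conj_class G y"
  using assms by (auto simp: conj_classes_def orbits_def conj_class_def)

lemma pow_mem_set_pow:
  assumes "x \<in> K" "x \<in> carrier G"
  shows "x [^] (n :: nat) \<in> set_pow G K n"
  using assms by (induction n) (auto simp: set_mult_def)

end

text \<open>\<open>num_factorizations G K n g\<close> is the number of \<open>n\<close>-tuples in \<open>K\<close> with product \<open>g\<close>.\<close>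

primrec num_factorizations :: "('a, 'b) monoid_scheme \<Rightarrow> 'a set \<Rightarrow> nat \<Rightarrow> 'a \<Rightarrow> nat" where
  "num_factorizations G K 0 g = of_bool (g = \<one>\<^bsub>G\<^esub>)"
| "num_factorizations G K (Suc n) g =
     (\<Sum>h\<in>carrier G. num_factorizations G K n h * of_bool (inv\<^bsub>G\<^esub> h \<otimes>\<^bsub>G\<^esub> g \<in> K))"

section \<open>Counting factorizations by means of characters\<close>

context finite_group
begin

lemma set_pow_subset: "K \<subseteq> carrier G \<Longrightarrow> set_pow G K n \<subseteq> carrier G"
  by (induction n) (auto simp: set_mult_def)

text \<open>A sum of natural numbers is positive exactly when some term is. A positive term means
  that h is a product of n factors and that the last factor \<open>inv h \<otimes> g\<close> lies in
  \<open>K\<close>.\<close>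

lemma num_factorizations_pos_iff:
  assumes K: "K \<subseteq> carrier G" and g: "g \<in> carrier G"
  shows "0 < num_factorizations G K n g \<longleftrightarrow> g \<in> set_pow G K n"
  using g
proof (induction n arbitrary: g)
  case 0
  then show ?case by auto
next
  case (Suc n)
  have "0 < num_factorizations G K (Suc n) g \<longleftrightarrow>
      (\<exists>h\<in>carrier G. 0 < num_factorizations G K n h * of_bool (inv h \<otimes> g \<in> K))"
    using sum_eq_0_iff[OF finite_carrier,
      of "\<lambda>h. num_factorizations G K n h * of_bool (inv h \<otimes> g \<in> K)"] by auto
  also have "\<dots> \<longleftrightarrow> (\<exists>h\<in>carrier G. h \<in> set_pow G K n \<and> inv h \<otimes> g \<in> K)"
    using Suc.IH by auto
  also have "\<dots> \<longleftrightarrow> g \<in> set_pow G K (Suc n)"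
  proof
    assume "\<exists>h\<in>carrier G. h \<in> set_pow G K n \<and> inv h \<otimes> g \<in> K"
    then obtain h where h: "h \<in> carrier G" "h \<in> set_pow G K n" "inv h \<otimes> g \<in> K" by blast
    have "g = h \<otimes> (inv h \<otimes> g)" using h(1) Suc.prems by (simp add: m_assoc[symmetric])
    then show "g \<in> set_pow G K (Suc n)" using h(2,3) by (auto simp: set_mult_def)
  next
    assume "g \<in> set_pow G K (Suc n)"
    then obtain h k where h: "h \<in> set_pow G K n" "k \<in> K" "g = h \<otimes> k" by (auto simp: set_mult_def)
    then have "h \<in> carrier G" "k \<in> carrier G" using set_pow_subset[OF K] K by blast+
    then have "inv h \<otimes> g = k" using h(3) by (simp add: m_assoc[symmetric])
    then show "\<exists>h\<in>carrier G. h \<in> set_pow G K n \<and> inv h \<otimes> g \<in> K"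
      using h \<open>h \<in> carrier G\<close> by blast
  qed
  finally show ?case .
qed

text \<open>Conjugating every factor permutes the tuples from the class and conjugates their
  product. In the recursion this is the substitution of a conjugate for the summation
  variable.\<close>

lemma num_factorizations_class_function:
  assumes x: "x \<in> carrier G" and t: "t \<in> carrier G" and g: "g \<in> carrier G"
  shows "num_factorizations G (conj_class G x) n (t \<otimes> g \<otimes> inv t) =
    num_factorizations G (conj_class G x) n g"
  using g
proof (induction n arbitrary: g)
  case 0
  have "t \<otimes> g \<otimes> inv t = \<one> \<longleftrightarrow> g = \<one>"
    using t 0 by (metis inv_closed inv_equality inv_inv l_cancel_one m_closed r_cancel_one r_inv)
  then show ?case by simp
next
  case (Suc n)
  let ?c = "\<lambda>g. t \<otimes> g \<otimes> inv t"
  have "num_factorizations G (conj_class G x) (Suc n) (?c g) =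
      (\<Sum>h\<in>carrier G. num_factorizations G (conj_class G x) n (?c h) *
        of_bool (inv (?c h) \<otimes> ?c g \<in> conj_class G x))"
    unfolding num_factorizations.simps
    by (rule sum.reindex_bij_betw[OF bij_betw_conjugation[OF t], symmetric])
  also have "\<dots> = num_factorizations G (conj_class G x) (Suc n) g"
    unfolding num_factorizations.simps
  proof (intro sum.cong refl)
    fix h assume h: "h \<in> carrier G"
    have cancel: "inv t \<otimes> (t \<otimes> z) = z" if "z \<in> carrier G" for z
      using that t by (simp add: m_assoc[symmetric])
    have e: "inv (?c h) \<otimes> ?c g = ?c (inv h \<otimes> g)"
      using h t Suc.prems by (simp add: inv_mult_group m_assoc cancel)
    show "num_factorizations G (conj_class G x) n (?c h) *
        of_bool (inv (?c h) \<otimes> ?c g \<in> conj_class G x) =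
      num_factorizations G (conj_class G x) n h * of_bool (inv h \<otimes> g \<in> conj_class G x)"
      unfolding e Suc.IH[OF h] using conj_mem_conj_class_iff[OF x t, of "inv h \<otimes> g"] h Suc.prems by simp
  qed
  finally show ?case .
qed

text \<open>Splits off the last factor k by substituting g = h k. The weight \<open>F\<close> is
  general because the identity is used with the constant 1 for the total count and with
  characters.\<close>

lemma sum_num_factorizations_Suc:
  fixes F :: "'a \<Rightarrow> 'c :: comm_semiring_1"
  assumes K: "K \<subseteq> carrier G"
  shows "(\<Sum>g\<in>carrier G. of_nat (num_factorizations G K (Suc n) g) * F g) =
    (\<Sum>k\<in>K. \<Sum>h\<in>carrier G. of_nat (num_factorizations G K n h) * F (h \<otimes> k))"
proof -
  let ?N = "\<lambda>h. of_nat (num_factorizations G K n h) :: 'c"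
  have "(\<Sum>g\<in>carrier G. of_nat (num_factorizations G K (Suc n) g) * F g) =
      (\<Sum>g\<in>carrier G. \<Sum>h\<in>carrier G. ?N h * (of_bool (inv h \<otimes> g \<in> K) * F g))"
    by (simp add: sum_distrib_right mult.assoc)
  also have "\<dots> = (\<Sum>h\<in>carrier G. \<Sum>g\<in>carrier G. ?N h * (of_bool (inv h \<otimes> g \<in> K) * F g))"
    by (rule sum.swap)
  also have "\<dots> = (\<Sum>h\<in>carrier G. \<Sum>k\<in>K. ?N h * F (h \<otimes> k))"
  proof (rule sum.cong[OF refl])
    fix h assume h: "h \<in> carrier G"
    have "(\<Sum>g\<in>carrier G. ?N h * (of_bool (inv h \<otimes> g \<in> K) * F g)) =
        (\<Sum>k\<in>carrier G. ?N h * (of_bool (inv h \<otimes> (h \<otimes> k) \<in> K) * F (h \<otimes> k)))"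
      by (rule sum.reindex_bij_betw[OF bij_betw_mult_left[OF h], symmetric])
    also have "\<dots> = (\<Sum>k\<in>carrier G. ?N h * (of_bool (k \<in> K) * F (h \<otimes> k)))"
      using h by (intro sum.cong refl) (simp add: m_assoc[symmetric])
    also have "\<dots> = (\<Sum>k\<in>K. ?N h * F (h \<otimes> k))"
      using K finite_carrier by (intro sum.mono_neutral_cong_right) auto
    finally show "(\<Sum>g\<in>carrier G. ?N h * (of_bool (inv h \<otimes> g \<in> K) * F g)) =
      (\<Sum>k\<in>K. ?N h * F (h \<otimes> k))" .
  qed
  also have "\<dots> = (\<Sum>k\<in>K. \<Sum>h\<in>carrier G. ?N h * F (h \<otimes> k))" by (rule sum.swap)
  finally show ?thesis .
qed

lemma sum_num_factorizations:
  assumes K: "K \<subseteq> carrier G"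
  shows "(\<Sum>g\<in>carrier G. num_factorizations G K n g) = card K ^ n"
proof (induction n)
  case 0
  have "(\<Sum>g\<in>carrier G. num_factorizations G K 0 g) = (\<Sum>g\<in>carrier G. if g = \<one> then 1 else 0)"
    by (intro sum.cong) auto
  then show ?case using finite_carrier by simp
next
  case (Suc n)
  then show ?case using sum_num_factorizations_Suc[OF K, of n "\<lambda>_. 1 :: nat"] by simp
qed

text \<open>By \<open>sum_class_function_mult_character\<close>, applied to the count of n-fold
  products and to each k in K, every further factor multiplies the character sum by |K| \<chi>(x) /
  \<chi>(1).\<close>

lemma sum_num_factorizations_character:
  assumes \<chi>: "\<chi> \<in> Irr G" and x: "x \<in> carrier G" and n: "0 < n"
  shows "\<chi> \<one> ^ (n - 1) * (\<Sum>g\<in>carrier G. of_nat (num_factorizations G (conj_class G x) n g) * \<chi> g) =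
    \<chi> x ^ n * of_nat (card (conj_class G x)) ^ n"
proof -
  let ?K = "conj_class G x"
  define S where "S n = (\<Sum>g\<in>carrier G. of_nat (num_factorizations G ?K n g) * \<chi> g)" for n
  have step: "\<chi> \<one> * S (Suc n) = S n * (of_nat (card ?K) * \<chi> x)" for n
  proof -
    have "\<chi> \<one> * S (Suc n) =
        (\<Sum>k\<in>?K. \<chi> \<one> * (\<Sum>h\<in>carrier G. of_nat (num_factorizations G ?K n h) * \<chi> (h \<otimes> k)))"
      unfolding S_def sum_num_factorizations_Suc[OF conj_class_subset[OF x]] by (rule sum_distrib_left)
    also have "\<dots> = (\<Sum>k\<in>?K. S n * \<chi> x)"
    proof (intro sum.cong refl)
      fix k assume k: "k \<in> ?K"
      then have kc: "k \<in> carrier G" using conj_class_subset[OF x] by blast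
      have "\<chi> k = \<chi> x" using k x Irr_class_function[OF \<chi> x] by (auto simp: conj_class_eq)
      then show "\<chi> \<one> * (\<Sum>h\<in>carrier G. of_nat (num_factorizations G ?K n h) * \<chi> (h \<otimes> k)) = S n * \<chi> x"
        unfolding S_def
        using sum_class_function_mult_character[OF \<chi> kc,
          of "\<lambda>g. of_nat (num_factorizations G ?K n g)"] num_factorizations_class_function[OF x] by simp
    qed
    finally show ?thesis by (simp add: mult_ac)
  qed
  have S0: "S 0 = \<chi> \<one>"
  proof -
    have "S 0 = (\<Sum>g\<in>carrier G. if g = \<one> then \<chi> g else 0)" unfolding S_def by (intro sum.cong) auto
    then show ?thesis using finite_carrier by simp
  qed
  have "\<chi> \<one> \<noteq> 0" by (rule Irr_one_neq_zero[OF \<chi>])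
  \<comment> \<open>The starting value \<open>S 0 = \<chi> \<one>\<close> absorbs one of the n
    divisions by the degree, whence the exponent n - 1; the induction runs over n =
    \<open>Suc m\<close>.\<close>
  have "\<chi> \<one> ^ m * S (Suc m) = (of_nat (card ?K) * \<chi> x) ^ Suc m" for m
  proof (induction m)
    case 0
    have "\<chi> \<one> * S (Suc 0) = \<chi> \<one> * (of_nat (card ?K) * \<chi> x)" using step[of 0] S0 by simp
    then show ?case using \<open>\<chi> \<one> \<noteq> 0\<close> by simp
  next
    case (Suc m)
    have "\<chi> \<one> ^ Suc m * S (Suc (Suc m)) = \<chi> \<one> ^ m * (\<chi> \<one> * S (Suc (Suc m)))" by (simp add: mult_ac)
    also have "\<dots> = (\<chi> \<one> ^ m * S (Suc m)) * (of_nat (card ?K) * \<chi> x)" by (simp add: step mult_ac)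
    finally show ?case unfolding Suc by (simp add: mult_ac)
  qed
  from this[of "n - 1"] n show ?thesis by (simp add: S_def power_mult_distrib mult_ac)
qed

text \<open>Frobenius's formula for class products: \<open>class_function_inversion\<close> for the
  count, with the character sums just computed.\<close>

lemma frobenius_formula:
  assumes x: "x \<in> carrier G" and n: "0 < n" and k: "k \<in> carrier G"
  shows "of_nat (num_factorizations G (conj_class G x) n k) =
    of_nat (card (conj_class G x)) ^ n / of_nat (card (carrier G)) *
      (\<Sum>\<chi>\<in>Irr G. \<chi> x ^ n * cnj (\<chi> k) / \<chi> \<one> ^ (n - 1))"
proof -
  let ?K = "conj_class G x" and ?N = "of_nat (card (carrier G)) :: complex"
  have N: "?N \<noteq> 0" using finite_carrier by auto
  have "?N * of_nat (num_factorizations G ?K n k) =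
      (\<Sum>\<chi>\<in>Irr G. (\<Sum>g\<in>carrier G. of_nat (num_factorizations G ?K n g) * \<chi> g) * \<chi> (inv k))"
    by (rule class_function_inversion) (use k in \<open>simp_all add: num_factorizations_class_function[OF x]\<close>)
  also have "\<dots> = (\<Sum>\<chi>\<in>Irr G. of_nat (card ?K) ^ n * (\<chi> x ^ n * cnj (\<chi> k) / \<chi> \<one> ^ (n - 1)))"
  proof (intro sum.cong refl)
    fix \<chi> assume \<chi>: "\<chi> \<in> Irr G"
    have "\<chi> \<one> \<noteq> 0" by (rule Irr_one_neq_zero[OF \<chi>])
    then have "(\<Sum>g\<in>carrier G. of_nat (num_factorizations G ?K n g) * \<chi> g) =
        \<chi> x ^ n * of_nat (card ?K) ^ n / \<chi> \<one> ^ (n - 1)"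
      using sum_num_factorizations_character[OF \<chi> x n] by (simp add: field_simps)
    then show "(\<Sum>g\<in>carrier G. of_nat (num_factorizations G ?K n g) * \<chi> g) * \<chi> (inv k) =
        of_nat (card ?K) ^ n * (\<chi> x ^ n * cnj (\<chi> k) / \<chi> \<one> ^ (n - 1))"
      by (simp add: character_inv[OF \<chi> k])
  qed
  also have "\<dots> = of_nat (card ?K) ^ n * (\<Sum>\<chi>\<in>Irr G. \<chi> x ^ n * cnj (\<chi> k) / \<chi> \<one> ^ (n - 1))"
    by (rule sum_distrib_left[symmetric])
  finally show ?thesis
    unfolding times_divide_eq_left nonzero_eq_divide_eq[OF N] by (simp only: mult.commute)
qed

lemma sum_conj_class:
  fixes f :: "'a \<Rightarrow> 'c :: semiring_1"
  assumes y: "y \<in> carrier G"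
    and f: "\<And>t g. t \<in> carrier G \<Longrightarrow> g \<in> carrier G \<Longrightarrow> f (t \<otimes> g \<otimes> inv t) = f g"
  shows "(\<Sum>g\<in>conj_class G y. f g) = of_nat (card (conj_class G y)) * f y"
proof -
  have "(\<Sum>g\<in>conj_class G y. f g) = (\<Sum>g\<in>conj_class G y. f y)"
    using y f by (intro sum.cong) (auto simp: conj_class_eq)
  then show ?thesis by simp
qed

text \<open>When \<open>y\<close> is conjugate to its inverse both terms count, so the value on the class is
  \<open>m1 + m2\<close>; this is what excludes an inversion-closed \<open>D\<close> in the theorem.\<close>

lemma num_factorizations_eq_if_character_eq:
  assumes x: "x \<in> carrier G" and n: "0 < n" and y: "y \<in> carrier G"
    and eq: "\<And>\<chi>. \<chi> \<in> Irr G \<Longrightarrow> \<chi> x ^ n * of_nat (card (conj_class G x)) ^ n =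
      \<chi> \<one> ^ (n - 1) * of_nat (card (conj_class G y)) * (of_nat m1 * \<chi> y + of_nat m2 * \<chi> (inv y))"
    and k: "k \<in> carrier G"
  shows "num_factorizations G (conj_class G x) n k =
    m1 * of_bool (k \<in> conj_class G y) + m2 * of_bool (k \<in> conj_class G (inv y))"
proof -
  let ?N = "of_nat (card (carrier G)) :: complex" and ?E = "conj_class G y" and ?E' = "conj_class G (inv y)"
  let ?F = "\<lambda>g. of_nat (num_factorizations G (conj_class G x) n g) :: complex"
  \<comment> \<open>The claimed value as a complex class function. The hypothesis says, up to the
    nonzero factor \<chi>(1)^(n-1), that \<open>f\<close> and the count have equal character
    sums.\<close>
  define f :: "'a \<Rightarrow> complex"
    where "f g = of_nat m1 * of_bool (g \<in> ?E) + of_nat m2 * of_bool (g \<in> ?E')" for g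
  have N: "?N \<noteq> 0" using finite_carrier by auto
  have f: "f (t \<otimes> g \<otimes> inv t) = f g" if "t \<in> carrier G" "g \<in> carrier G" for t g
    using that y by (simp add: f_def conj_mem_conj_class_iff)
  have "?N * ?F k = (\<Sum>\<chi>\<in>Irr G. (\<Sum>g\<in>carrier G. ?F g * \<chi> g) * \<chi> (inv k))"
    by (rule class_function_inversion) (use k in \<open>simp_all add: num_factorizations_class_function[OF x]\<close>)
  also have "\<dots> = (\<Sum>\<chi>\<in>Irr G. (\<Sum>g\<in>carrier G. f g * \<chi> g) * \<chi> (inv k))"
  proof (intro sum.cong refl)
    fix \<chi> assume \<chi>: "\<chi> \<in> Irr G"
    have \<chi>1: "\<chi> \<one> \<noteq> 0" by (rule Irr_one_neq_zero[OF \<chi>])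
    have cls: "(\<Sum>g\<in>carrier G. of_bool (g \<in> conj_class G z) * \<chi> g) = of_nat (card (conj_class G z)) * \<chi> z"
      if z: "z \<in> carrier G" for z
    proof -
      have "(\<Sum>g\<in>carrier G. of_bool (g \<in> conj_class G z) * \<chi> g) = (\<Sum>g\<in>conj_class G z. \<chi> g)"
        using conj_class_subset[OF z] finite_carrier by (intro sum.mono_neutral_cong_right) auto
      then show ?thesis using sum_conj_class[OF z, of \<chi>] Irr_class_function[OF \<chi>] by simp
    qed
    have "(\<Sum>g\<in>carrier G. f g * \<chi> g) = of_nat m1 * (\<Sum>g\<in>carrier G. of_bool (g \<in> ?E) * \<chi> g) +
        of_nat m2 * (\<Sum>g\<in>carrier G. of_bool (g \<in> ?E') * \<chi> g)"
      by (simp add: f_def distrib_right sum.distrib sum_distrib_left mult.assoc)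
    also have "\<dots> = of_nat (card ?E) * (of_nat m1 * \<chi> y + of_nat m2 * \<chi> (inv y))"
      unfolding cls[OF y] cls[OF inv_closed[OF y]] card_conj_class_inv[OF y] by (simp add: algebra_simps)
    finally have "\<chi> \<one> ^ (n - 1) * (\<Sum>g\<in>carrier G. f g * \<chi> g) =
        \<chi> \<one> ^ (n - 1) * (\<Sum>g\<in>carrier G. ?F g * \<chi> g)"
      unfolding sum_num_factorizations_character[OF \<chi> x n] eq[OF \<chi>] by (simp only: mult.assoc)
    then show "(\<Sum>g\<in>carrier G. ?F g * \<chi> g) * \<chi> (inv k) = (\<Sum>g\<in>carrier G. f g * \<chi> g) * \<chi> (inv k)"
      using \<chi>1 by simp
  qed
  also have "\<dots> = ?N * f k" by (rule class_function_inversion[OF f k, symmetric])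
  finally have "?F k = f k" using N by simp
  also have "\<dots> = of_nat (m1 * of_bool (k \<in> ?E) + m2 * of_bool (k \<in> ?E'))" by (simp add: f_def)
  finally show ?thesis unfolding of_nat_eq_iff .
qed

text \<open>Any \<open>y\<close> in the union may serve as representative. It may lie in the inverse
  class instead of \<open>D\<close>, so only facts symmetric under exchanging the two classes are
  claimed; they are applied to y = x^n.\<close>

lemma union_conj_class_inv:
  assumes D: "D \<in> conj_classes G" and y: "y \<in> D \<union> set_inv D"
  shows "y \<in> carrier G" and "D \<union> set_inv D = conj_class G y \<union> conj_class G (inv y)"
    and "card D = card (conj_class G y)"
    and "D = set_inv D \<longleftrightarrow> conj_class G y = conj_class G (inv y)"
proof -
  obtain z where z: "z \<in> carrier G" "D = conj_class G z" by (rule conj_classesE[OF D])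
  have Di: "set_inv D = conj_class G (inv z)" using z set_inv_conj_class by simp
  have zi: "inv z \<in> carrier G" using z by simp
  show yc: "y \<in> carrier G"
    using y conj_class_subset[OF z(1), folded z(2)] conj_class_subset[OF zi, folded Di] by blast
  have "(conj_class G y = D \<and> conj_class G (inv y) = set_inv D) \<or>
      (conj_class G y = set_inv D \<and> conj_class G (inv y) = D)"
  proof (cases "y \<in> D")
    case True
    then have "conj_class G y = D" using conj_class_eq_if_mem[OF z(1)] z(2) by simp
    then show ?thesis using set_inv_conj_class[OF yc] by simp
  next
    case False
    then have "conj_class G y = set_inv D" using y conj_class_eq_if_mem[OF zi] Di by simp
    then show ?thesis using set_inv_conj_class[OF yc] set_inv_conj_class[OF zi] z Di by simp
  qed
  then show "D \<union> set_inv D = conj_class G y \<union> conj_class G (inv y)"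
    and "card D = card (conj_class G y)"
    and "D = set_inv D \<longleftrightarrow> conj_class G y = conj_class G (inv y)"
    using card_conj_class_inv[OF yc] by auto
qed

lemma conj_class_disjoint:
  assumes y: "y \<in> carrier G" and z: "z \<in> carrier G" and ne: "conj_class G y \<noteq> conj_class G z"
  shows "conj_class G y \<inter> conj_class G z = {}"
  using conj_class_eq_if_mem[OF y] conj_class_eq_if_mem[OF z] ne by blast

text \<open>The count vanishes outside the two classes, which are disjoint and of equal size, and it
  is constant on each of them.\<close>

lemma sum_over_two_classes:
  fixes f :: "'a \<Rightarrow> 'c :: semiring_1"
  assumes x: "x \<in> carrier G" and y: "y \<in> carrier G"
    and pow: "set_pow G (conj_class G x) n = conj_class G y \<union> conj_class G (inv y)"
    and ne: "conj_class G y \<noteq> conj_class G (inv y)"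
    and f: "\<And>t g. t \<in> carrier G \<Longrightarrow> g \<in> carrier G \<Longrightarrow> f (t \<otimes> g \<otimes> inv t) = f g"
  shows "(\<Sum>g\<in>carrier G. of_nat (num_factorizations G (conj_class G x) n g) * f g) =
    of_nat (card (conj_class G y)) * (of_nat (num_factorizations G (conj_class G x) n y) * f y +
      of_nat (num_factorizations G (conj_class G x) n (inv y)) * f (inv y))"
proof -
  let ?F = "\<lambda>g. of_nat (num_factorizations G (conj_class G x) n g) * f g"
  let ?E = "conj_class G y" and ?E' = "conj_class G (inv y)"
  have yi: "inv y \<in> carrier G" using y by simp
  have sub: "?E \<subseteq> carrier G" "?E' \<subseteq> carrier G" using conj_class_subset y yi by blast+
  have zero: "?F g = 0" if "g \<in> carrier G - (?E \<union> ?E')" for g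
    using that num_factorizations_pos_iff[OF conj_class_subset[OF x], of g n] pow by auto
  have "(\<Sum>g\<in>carrier G. ?F g) = (\<Sum>g\<in>?E \<union> ?E'. ?F g)"
    using sub zero finite_carrier by (intro sum.mono_neutral_right) auto
  also have "\<dots> = (\<Sum>g\<in>?E. ?F g) + (\<Sum>g\<in>?E'. ?F g)"
    using sub finite_carrier conj_class_disjoint[OF y yi ne]
    by (intro sum.union_disjoint) (auto intro: finite_subset)
  also have "\<dots> = of_nat (card ?E) * ?F y + of_nat (card ?E') * ?F (inv y)"
    using f num_factorizations_class_function[OF x]
    by (subst (1 2) sum_conj_class) (use y in auto)
  finally show ?thesis using y by (simp add: card_conj_class_inv distrib_left)
qed

end

text \<open>The character conditions see \<open>D\<close> only through its size, so any other class
  of that size would satisfy them too; the membership of x^n in the union ties them to the right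
  class. The formulas are multiplied through by |K|^n where the English has it on the left, and
  \<open>x [^] (- int n)\<close> is the inverse of x^n.\<close>

theorem theorem13:
  fixes G :: "('a, 'b) monoid_scheme" (structure) and x :: 'a and n :: nat
    and K D :: "'a set"
  assumes "group G" and "finite (carrier G)"
    and "x \<in> carrier G" and "K = conj_class G x"
    and "0 < n"
    and "D \<in> conj_classes G"
  shows
    "((set_pow G K n = D \<union> set_inv D \<and> D \<noteq> set_inv D) \<longleftrightarrow>
       (x [^] n \<in> D \<union> set_inv D \<and>
        (\<exists>m1 m2 :: nat. 0 < m1 \<and> 0 < m2 \<and>
           (\<forall>\<chi> \<in> Irr G. \<chi> x ^ n * of_nat (card K) ^ n =
              \<chi> \<one> ^ (n - 1) * of_nat (card D) *
                (of_nat m1 * \<chi> (x [^] n) + of_nat m2 * \<chi> (x [^] (- int n)))) \<and>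
           card K ^ n = (m1 + m2) * card D \<and>
           of_nat m1 = of_nat (card K) ^ n / of_nat (card (carrier G)) *
             (\<Sum>\<chi> \<in> Irr G. \<chi> x ^ n * cnj (\<chi> (x [^] n)) / \<chi> \<one> ^ (n - 1)) \<and>
           of_nat m2 = of_nat (card K) ^ n / of_nat (card (carrier G)) *
             (\<Sum>\<chi> \<in> Irr G. \<chi> x ^ n * \<chi> (x [^] n) / \<chi> \<one> ^ (n - 1))))) \<and>
     (set_pow G K n = D \<union> set_inv D \<longrightarrow>
       (\<forall>\<chi> \<in> Irr G. \<chi> x ^ n + \<chi> (inv x) ^ n =
          \<chi> \<one> ^ (n - 1) * (\<chi> (x [^] n) + \<chi> (x [^] (- int n)))))"
proof -
  interpret group G by fact
  interpret finite_group G by unfold_locales fact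
  note x = \<open>x \<in> carrier G\<close> and n = \<open>0 < n\<close> and D = \<open>D \<in> conj_classes G\<close>
  note K = \<open>K = conj_class G x\<close>
  have Ksub: "K \<subseteq> carrier G" unfolding K by (rule conj_class_subset[OF x])
  define y where "y = x [^] n"
  have y: "y \<in> carrier G" and yi: "inv y \<in> carrier G" using x by (auto simp: y_def)
  have neg: "x [^] (- int n) = inv y" using x by (simp add: y_def int_pow_neg int_pow_int)
  have ypow: "y \<in> set_pow G K n"
    unfolding y_def by (rule pow_mem_set_pow) (use x K conj_class_self in auto)
  let ?\<nu> = "num_factorizations G K n"
  let ?c = "of_nat (card K) ^ n / of_nat (card (carrier G)) :: complex"
  have m1: "of_nat (?\<nu> y) = ?c * (\<Sum>\<chi> \<in> Irr G. \<chi> x ^ n * cnj (\<chi> y) / \<chi> \<one> ^ (n - 1))"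
    unfolding K by (rule frobenius_formula[OF x n y])
  \<comment> \<open>\<open>frobenius_formula\<close> at \<open>inv y\<close> yields the conjugate of
    \<open>\<chi> (inv y)\<close>, which is \<open>\<chi> y\<close>.\<close>
  have m2: "of_nat (?\<nu> (inv y)) = ?c * (\<Sum>\<chi> \<in> Irr G. \<chi> x ^ n * \<chi> y / \<chi> \<one> ^ (n - 1))"
    unfolding K frobenius_formula[OF x n yi] using y by (simp add: character_inv cong: sum.cong)
  have fwd: "\<exists>m1 m2 :: nat. 0 < m1 \<and> 0 < m2 \<and>
       (\<forall>\<chi> \<in> Irr G. \<chi> x ^ n * of_nat (card K) ^ n =
          \<chi> \<one> ^ (n - 1) * of_nat (card D) * (of_nat m1 * \<chi> y + of_nat m2 * \<chi> (inv y))) \<and>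
       card K ^ n = (m1 + m2) * card D \<and>
       of_nat m1 = ?c * (\<Sum>\<chi> \<in> Irr G. \<chi> x ^ n * cnj (\<chi> y) / \<chi> \<one> ^ (n - 1)) \<and>
       of_nat m2 = ?c * (\<Sum>\<chi> \<in> Irr G. \<chi> x ^ n * \<chi> y / \<chi> \<one> ^ (n - 1))"
    and yD: "y \<in> D \<union> set_inv D"
    if pow: "set_pow G K n = D \<union> set_inv D" and ne: "D \<noteq> set_inv D"
  proof -
    show yD: "y \<in> D \<union> set_inv D" using ypow pow by simp
    note u = union_conj_class_inv[OF D yD]
    have pow': "set_pow G (conj_class G x) n = conj_class G y \<union> conj_class G (inv y)"
      using pow u(2) K by simp
    have ne': "conj_class G y \<noteq> conj_class G (inv y)" using ne u(4) by simp
    \<comment> \<open>With a character as weight this gives the character identity, with the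
      constant 1 the equation for |K|^n.\<close>
    note two = sum_over_two_classes[OF x y pow' ne', folded K u(3)]
    have "0 < ?\<nu> y" "0 < ?\<nu> (inv y)"
      using num_factorizations_pos_iff[OF Ksub] pow' y yi conj_class_self unfolding K by auto
    moreover have "\<chi> x ^ n * of_nat (card K) ^ n =
        \<chi> \<one> ^ (n - 1) * of_nat (card D) * (of_nat (?\<nu> y) * \<chi> y + of_nat (?\<nu> (inv y)) * \<chi> (inv y))"
      if \<chi>: "\<chi> \<in> Irr G" for \<chi>
      using sum_num_factorizations_character[OF \<chi> x n, folded K]
        two[of \<chi>] Irr_class_function[OF \<chi>] by (simp add: mult.assoc)
    moreover have "card K ^ n = (?\<nu> y + ?\<nu> (inv y)) * card D"
      using two[of "\<lambda>_. 1 :: nat"] sum_num_factorizations[OF Ksub, of n] by (simp add: mult.commute)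
    ultimately show "\<exists>m1 m2 :: nat. 0 < m1 \<and> 0 < m2 \<and>
       (\<forall>\<chi> \<in> Irr G. \<chi> x ^ n * of_nat (card K) ^ n =
          \<chi> \<one> ^ (n - 1) * of_nat (card D) * (of_nat m1 * \<chi> y + of_nat m2 * \<chi> (inv y))) \<and>
       card K ^ n = (m1 + m2) * card D \<and>
       of_nat m1 = ?c * (\<Sum>\<chi> \<in> Irr G. \<chi> x ^ n * cnj (\<chi> y) / \<chi> \<one> ^ (n - 1)) \<and>
       of_nat m2 = ?c * (\<Sum>\<chi> \<in> Irr G. \<chi> x ^ n * \<chi> y / \<chi> \<one> ^ (n - 1))"
      using m1 m2 by blast
  qed
  have bwd: "set_pow G K n = D \<union> set_inv D \<and> D \<noteq> set_inv D"
    if yD: "y \<in> D \<union> set_inv D" and pos: "0 < k1" "0 < k2"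
      and eq: "\<forall>\<chi> \<in> Irr G. \<chi> x ^ n * of_nat (card K) ^ n =
          \<chi> \<one> ^ (n - 1) * of_nat (card D) * (of_nat k1 * \<chi> y + of_nat k2 * \<chi> (inv y))"
      and k1: "of_nat k1 = ?c * (\<Sum>\<chi> \<in> Irr G. \<chi> x ^ n * cnj (\<chi> y) / \<chi> \<one> ^ (n - 1))"
    for k1 k2 :: nat
  proof -
    note u = union_conj_class_inv[OF D yD]
    have \<nu>: "?\<nu> k = k1 * of_bool (k \<in> conj_class G y) + k2 * of_bool (k \<in> conj_class G (inv y))"
      if "k \<in> carrier G" for k
      unfolding K using eq u(3) K by (intro num_factorizations_eq_if_character_eq[OF x n y _ that]) simp
    have "k \<in> set_pow G K n \<longleftrightarrow> k \<in> conj_class G y \<union> conj_class G (inv y)" if k: "k \<in> carrier G" for k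
      unfolding num_factorizations_pos_iff[OF Ksub k, symmetric] \<nu>[OF k] using pos by auto
    then have "set_pow G K n = D \<union> set_inv D"
      unfolding u(2) using set_pow_subset[OF Ksub] conj_class_subset[OF y] conj_class_subset[OF yi] by blast
    \<comment> \<open>The count at \<open>y\<close> is \<open>k1\<close> by the formula assumed for
      it. If the two classes coincided, both indicators would be 1 at \<open>y\<close> and the count
      would be \<open>k1 + k2\<close>.\<close>
    moreover have "D \<noteq> set_inv D"
    proof
      assume "D = set_inv D"
      then have "?\<nu> y = k1 + k2" using \<nu>[OF y] u(4) conj_class_self[OF y] by simp
      moreover have "complex_of_nat (?\<nu> y) = of_nat k1" using m1 k1 by simp
      ultimately show False using pos by simp
    qed
    ultimately show ?thesis by simp
  qed
  \<comment> \<open>\<chi>(g) + \<chi>(g^(-1)) has the same value at all g in D and its inverse.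
    Adding the character sum to its conjugate therefore leaves only the total count |K|^n, however
    the count is distributed; the case D = D^(-1) is included.\<close>
  have symm: "\<chi> x ^ n + \<chi> (inv x) ^ n = \<chi> \<one> ^ (n - 1) * (\<chi> y + \<chi> (inv y))"
    if pow: "set_pow G K n = D \<union> set_inv D" and \<chi>: "\<chi> \<in> Irr G" for \<chi>
  proof -
    have yD: "y \<in> D \<union> set_inv D" using ypow pow by simp
    note u = union_conj_class_inv[OF D yD]
    let ?S = "\<Sum>g\<in>carrier G. of_nat (?\<nu> g) * \<chi> g"
    have S: "\<chi> \<one> ^ (n - 1) * ?S = \<chi> x ^ n * of_nat (card K) ^ n"
      unfolding K by (rule sum_num_factorizations_character[OF \<chi> x n])
    obtain d where d: "\<chi> \<one> = of_nat d" by (rule IrrE[OF \<chi>]) (rule that)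
    \<comment> \<open>The degree is a natural number, so conjugation fixes its power, while it turns
      \<open>\<chi> x\<close> into \<open>\<chi> (inv x)\<close>.\<close>
    have "\<chi> \<one> ^ (n - 1) * cnj ?S = cnj (\<chi> \<one> ^ (n - 1) * ?S)" by (simp add: d)
    also have "\<dots> = \<chi> (inv x) ^ n * of_nat (card K) ^ n" unfolding S by (simp add: character_inv[OF \<chi> x])
    finally have S': "\<chi> \<one> ^ (n - 1) * cnj ?S = \<chi> (inv x) ^ n * of_nat (card K) ^ n" .
    have "?S + cnj ?S = (\<Sum>g\<in>carrier G. of_nat (?\<nu> g) * (\<chi> g + \<chi> (inv g)))"
      by (simp add: cnj_sum character_inv[OF \<chi>] distrib_left sum.distrib cong: sum.cong)
    also have "\<dots> = (\<Sum>g\<in>carrier G. of_nat (?\<nu> g) * (\<chi> y + \<chi> (inv y)))"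
    proof (intro sum.cong refl)
      fix g assume g: "g \<in> carrier G"
      show "of_nat (?\<nu> g) * (\<chi> g + \<chi> (inv g)) = of_nat (?\<nu> g) * (\<chi> y + \<chi> (inv y))"
      proof (cases "?\<nu> g = 0")
        case False
        then have "g \<in> conj_class G y \<union> conj_class G (inv y)"
          using num_factorizations_pos_iff[OF Ksub g, of n] pow u(2) by simp
        then have "\<chi> g = \<chi> y \<or> \<chi> g = \<chi> (inv y)"
          using y yi Irr_class_function[OF \<chi>] by (auto simp: conj_class_eq)
        then show ?thesis using g y by (auto simp: character_inv[OF \<chi>])
      qed simp
    qed
    also have "\<dots> = of_nat (\<Sum>g\<in>carrier G. ?\<nu> g) * (\<chi> y + \<chi> (inv y))"
      by (simp add: sum_distrib_right)
    also have "\<dots> = of_nat (card K) ^ n * (\<chi> y + \<chi> (inv y))"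
      by (simp add: sum_num_factorizations[OF Ksub])
    finally have T: "?S + cnj ?S = of_nat (card K) ^ n * (\<chi> y + \<chi> (inv y))" .
    have "of_nat (card K) ^ n * (\<chi> x ^ n + \<chi> (inv x) ^ n) = \<chi> \<one> ^ (n - 1) * (?S + cnj ?S)"
      using S S' by (simp only: distrib_left mult.commute)
    also have "\<dots> = of_nat (card K) ^ n * (\<chi> \<one> ^ (n - 1) * (\<chi> y + \<chi> (inv y)))"
      unfolding T by (simp only: mult.left_commute)
    finally have "of_nat (card K) ^ n * (\<chi> x ^ n + \<chi> (inv x) ^ n) =
        of_nat (card K) ^ n * (\<chi> \<one> ^ (n - 1) * (\<chi> y + \<chi> (inv y)))" .
    moreover have "card K \<noteq> 0"
      using finite_subset[OF Ksub finite_carrier] conj_class_self[OF x] K by auto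
    ultimately show ?thesis by simp
  qed
  show ?thesis
    unfolding neg y_def[symmetric] using fwd yD bwd symm by blast
qed

end
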